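(* Let $d\ge0$ be an integer. There exist a constant $C_4$ depending only on $d$ and constants $C_{5,\ell}$ ($\ell=0,\dots,d$) depending only on $\ell$ and $d$ such that the following holds. Let $A^*,B^*,R^*>0$, and suppose that the single-jump parameters satisfy $|a_\ell|\le A^*$ for $\ell=0,\dots,d$ and $|a_0|\ge B^*$, and that the data $\widetilde m_k=m_k+\delta_k$ satisfy $|\delta_k|\le R^*k^{-1}$ for $k=N,2N,\dots,(d+2)N$. Then for all sufficiently large $N$, the single-jump decimated algorithm described in the context, applied to these data (with the jump $\xi$ known a priori with accuracy $o(N^{-1})$), produces $\widetilde\xi$ and $\widetilde\alpha_0,\dots,\widetilde\alpha_d$ with $$|\widetilde\xi-\xi|\le C_4\frac{R^*}{B^*}N^{-d-2},$$ $$|\widetilde\alpha_\ell-\alpha_\ell|\le C_{5,\ell}\,R^*\Big(1+\frac{A^*}{B^*}\Big)N^{-\ell-1},\qquad \ell=0,1,\dots,d.$$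
   Context: Setting. $\xi\in[-\pi,\pi]$ is the jump location, $\omega=e^{-\imath\xi}$, and $a_0,\dots,a_d$ are the jump magnitudes. Put $\alpha_\ell=\imath^{d+1-\ell}a_{d-\ell}$ for $\ell=0,\dots,d$ and $m_k=\omega^k\sum_{\ell=0}^d\alpha_\ell k^\ell$. (These arise from $\widetilde c_k=\frac{\omega^k}{2\pi}\sum_{\ell=0}^d\frac{a_\ell}{(\imath k)^{\ell+1}}+\epsilon_k$, $|\epsilon_k|=O(k^{-d-2})$, via $\widetilde m_k=2\pi(\imath k)^{d+1}\widetilde c_k$.) The perturbed values $\widetilde m_k=m_k+\delta_k$ are given for $k=N,2N,\dots,(d+2)N$. The a-priori information is a number $\xi_N^{0}$ with $|\xi^0_N-\xi|\le\rho_N/N$, where $\rho_N\to0$ as $N\to\infty$. "Sufficiently large $N$" means $N\ge N_0$ with $N_0$ depending on $d,A^*,B^*,R^*$ and the sequence $(\rho_N)$. Single-jump decimated algorithm: 1. Form $q_N^d(u)=\sum_{j=0}^{d+1}(-1)^j\binom{d+1}{j}\widetilde m_{(j+1)N}\,u^{d+1-j}$. 2. Let $\widetilde z$ be the root of $q_N^d$ closest to the unit circle. 3. Let $\widetilde\omega$ be an $N$-th root of $\widetilde z$; among the $N$ possible values choose the one consistent with the a-priori knowledge, i.e. the one closest to $e^{-\imath\xi_N^0}$. 4. Set $\widetilde\xi=-\arg\widetilde\omega$ (the value of the argument modulo $2\pi$ being the one for which $\widetilde\xi$ is closest to $\xi_N^0$). 5. Let $\widetilde\alpha_0,\dots,\widetilde\alpha_d$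 be the solution of the linear system $\widetilde m_{jN}\,\widetilde\omega^{-jN}=\sum_{\ell=0}^d(jN)^\ell\,\widetilde\alpha_\ell$, $j=1,\dots,d+1$. *)

theory Defs
  imports "HOL-Analysis.Analysis" "HOL-Computational_Algebra.Polynomial"
begin

definition jump_alpha :: "nat \<Rightarrow> (nat \<Rightarrow> complex) \<Rightarrow> nat \<Rightarrow> complex" where
  "jump_alpha d a l = \<i> ^ (d + 1 - l) * a (d - l)"

definition jump_moment :: "nat \<Rightarrow> real \<Rightarrow> (nat \<Rightarrow> complex) \<Rightarrow> nat \<Rightarrow> complex" where
  "jump_moment d \<xi> a k =
     exp (- \<i> * of_real \<xi>) ^ k * (\<Sum>l\<le>d. jump_alpha d a l * of_nat k ^ l)"

definition decimated_poly :: "nat \<Rightarrow> nat \<Rightarrow> (nat \<Rightarrow> complex) \<Rightarrow> complex poly" where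
  "decimated_poly d N m =
     (\<Sum>j\<le>d + 1. monom ((-1) ^ j * of_nat (d + 1 choose j) * m ((j + 1) * N)) (d + 1 - j))"

text \<open>
  The algorithm is a relation between its input (the data \<open>m\<close> and the a-priori approximation
  \<open>\<xi>0\<close> of the jump) and its output \<open>\<xi>'\<close>, \<open>\<alpha>' 0, \<dots>, \<alpha>' d\<close>, so that any way of breaking ties
  between equally close candidates is allowed; values of \<open>\<alpha>'\<close> beyond \<open>d\<close> are unconstrained.
  Since \<open>\<omega>\<close> approximates \<open>exp (- \<i> * \<xi>)\<close>, it is \<open>- \<xi>'\<close> that has to be an argument of \<open>\<omega>\<close>.
\<close>

definition decimated_output ::
    "nat \<Rightarrow> nat \<Rightarrow> (nat \<Rightarrow> complex) \<Rightarrow> real \<Rightarrow> real \<Rightarrow> (nat \<Rightarrow> complex) \<Rightarrow> bool" where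
  "decimated_output d N m \<xi>0 \<xi>' \<alpha>' \<longleftrightarrow>
     (\<exists>z \<omega>.
        is_arg_min (\<lambda>u. infdist u (sphere 0 1)) (\<lambda>u. poly (decimated_poly d N m) u = 0) z \<and>
        is_arg_min (\<lambda>w. dist w (exp (- \<i> * of_real \<xi>0))) (\<lambda>w. w ^ N = z) \<omega> \<and>
        is_arg_min (\<lambda>x. \<bar>x - \<xi>0\<bar>) (\<lambda>x. is_Arg \<omega> (- x)) \<xi>' \<and>
        (\<forall>j\<in>{1..d + 1}.
           m (j * N) * \<omega> powi (- int (j * N)) = (\<Sum>l\<le>d. of_nat (j * N) ^ l * \<alpha>' l)))"

end

theory Submission
  imports Defs "HOL-Computational_Algebra.Fundamental_Theorem_Algebra"
begin

text \<open>
  Write \<open>w = exp (- \<i> * \<xi>) ^ N\<close> and \<open>n = d + 1\<close>. For exact data, \<open>m (j * N) = w ^ j * P (j * N)\<close> with a polynomial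
  \<open>P\<close> of degree \<open>d\<close>, so the decimated polynomial at \<open>u = w * v\<close> is \<open>w ^ (d + 2)\<close> times
  \<open>\<Sum>j\<le>n. (-1) ^ j * (n choose j) * P ((j + 1) * N) * v ^ (n - j)\<close>. At \<open>v = 1\<close> this is an \<open>n\<close>-th finite
  difference of a polynomial of degree \<open>d < n\<close>, so \<open>w\<close> is a root. After division by the leading term
  \<open>\<alpha> d * N ^ d\<close> of \<open>P\<close>, the coefficients converge, at a rate that depends only on \<open>A / (B * N)\<close>, to
  those of \<open>E v = (\<Sum>j\<le>n. (-1) ^ j * (n choose j) * (j + 1) ^ d * v ^ (n - j))\<close>.

  The main point is that \<open>E\<close> has a simple root at \<open>1\<close> and no other root in the closed unit disc
  (\<open>alt_binom_poly_power_factor\<close>). Indeed \<open>E\<close> arises from \<open>(v - 1) ^ n\<close> by applying \<open>d\<close> times the operator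
  \<open>p \<mapsto> (n + 1) * p - v * p'\<close>; each application lowers the multiplicity of the root \<open>1\<close> by one, and
  an estimate of the real part of \<open>v * p' / p\<close> shows that no new root enters the disc. Hence
  \<open>norm (E v) \<ge> c * norm (v - 1)\<close> on a disc that contains a neighbourhood of the unit circle. For large \<open>N\<close> the
  noisy polynomial is small at \<open>1\<close>, so it has a root near \<open>1\<close>; the root closest to the circle
  then lies in that disc, and the lower bound shows that its distance from \<open>1\<close> is at most a constant times the noise,
  which after normalization is \<open>R / (B * N ^ (d + 1))\<close> (\<open>alt_binom_poly_closest_root\<close>).

  Extracting an \<open>N\<close>-th root divides this error by \<open>N\<close>, and the a-priori information, being of accuracy \<open>o (1 / N)\<close>,
  singles out the right root because \<open>N\<close>-th roots are at least about \<open>1 / N\<close> apart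
  (\<open>closest_nth_root\<close>, \<open>closest_arg\<close>). Finally the amplitudes, scaled by \<open>N ^ l\<close>, solve an
  interpolation problem at the fixed nodes \<open>1, \<dots>, d + 1\<close> whose right-hand side is off by
  order \<open>R * (1 + A / B) / N\<close> (\<open>amplitude_system_error\<close>, \<open>interpolation_system_iff\<close>).
\<close>

section \<open>Location and size estimates for roots of complex polynomials\<close>

text \<open>The Moebius map \<open>v \<mapsto> (r + v) / (r - v)\<close>, which equals \<open>1 - 2 * v / (v - r)\<close>, sends the
  closed disc of radius \<open>norm r\<close>, without \<open>r\<close>, to the closed right half plane.\<close>
lemma Re_div_diff_le_half:
  fixes v r :: complex
  assumes "norm v \<le> norm r" "v \<noteq> r"
  shows "Re (v / (v - r)) \<le> 1 / 2"
proof -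
  have sq: "(norm v)\<^sup>2 \<le> (norm r)\<^sup>2"
    using assms(1) by (simp add: power_mono)
  have pos: "(Re v - Re r)\<^sup>2 + (Im v - Im r)\<^sup>2 > 0"
    using assms(2) by (metis complex_eq_iff eq_iff_diff_eq_0 sum_power2_gt_zero_iff)
  have "2 * (Re v * (Re v - Re r) + Im v * (Im v - Im r)) \<le> (Re v - Re r)\<^sup>2 + (Im v - Im r)\<^sup>2"
    using sq unfolding cmod_power2 by (simp add: power2_eq_square algebra_simps)
  then show ?thesis
    using pos by (simp add: Re_divide field_simps)
qed

text \<open>The logarithmic derivative is \<open>\<Sum> 1 / (v - r)\<close> over the roots \<open>r\<close>, all of which lie outside the
  closed unit disc, so that each of the \<open>degree p\<close> terms contributes at most \<open>1 / 2\<close>.\<close>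
lemma Re_log_deriv_le_half_degree:
  fixes p :: "complex poly"
  assumes "\<And>u. norm u \<le> 1 \<Longrightarrow> poly p u \<noteq> 0" "norm v \<le> 1"
  shows "Re (v * poly (pderiv p) v / poly p v) \<le> degree p / 2"
  using assms(1)
proof (induction "degree p" arbitrary: p)
  case 0
  then obtain c where "p = [:c:]" by (metis degree_eq_zeroE)
  then show ?case by simp
next
  case (Suc n)
  have "\<not> constant (poly p)"
    using Suc.hyps(2) by (simp add: constant_degree)
  then obtain r where r: "poly p r = 0"
    using fundamental_theorem_of_algebra by blast
  then obtain q where pq: "p = [:-r, 1:] * q"
    by (metis dvdE poly_eq_0_iff_dvd)
  have q0: "q \<noteq> 0" using Suc.hyps(2) pq by auto
  have dq: "degree p = Suc (degree q)" using q0 unfolding pq by (subst degree_mult_eq) auto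
  have nzq: "poly q u \<noteq> 0" if "norm u \<le> 1" for u
    using Suc.prems[OF that] pq by auto
  have IH: "Re (v * poly (pderiv q) v / poly q v) \<le> degree q / 2"
    using Suc.hyps dq nzq by simp
  have rgt: "norm r > 1" using Suc.prems r by force
  have "v \<noteq> r" using rgt assms(2) by auto
  have qv: "poly q v \<noteq> 0" using nzq assms(2) by simp
  have "poly (pderiv p) v = (v - r) * poly (pderiv q) v + poly q v"
    unfolding pq by (subst pderiv_mult) (simp add: pderiv_pCons algebra_simps)
  moreover have "poly p v = (v - r) * poly q v" unfolding pq by (simp add: algebra_simps)
  ultimately have "v * poly (pderiv p) v / poly p v = v / (v - r) + v * poly (pderiv q) v / poly q v"
    using \<open>v \<noteq> r\<close> qv by (simp add: divide_simps) (simp add: algebra_simps)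
  moreover have "Re (v / (v - r)) \<le> 1 / 2"
    using rgt assms(2) \<open>v \<noteq> r\<close> by (intro Re_div_diff_le_half) auto
  ultimately show ?case using IH dq by simp
qed

text \<open>Read backwards: a polynomial that is small at \<open>a\<close> and whose leading coefficient is not small has a
  root near \<open>a\<close>. For the perturbed polynomial this takes the place of a Rouche argument.\<close>
lemma norm_poly_ge_root_dist:
  fixes p :: "complex poly"
  assumes "\<And>r. poly p r = 0 \<Longrightarrow> s \<le> norm (a - r)" "0 \<le> s"
  shows "norm (lead_coeff p) * s ^ degree p \<le> norm (poly p a)"
  using assms(1)
proof (induction "degree p" arbitrary: p)
  case 0
  then obtain c where "p = [:c:]" by (metis degree_eq_zeroE)
  then show ?case by simp
next
  case (Suc n)
  have "\<not> constant (poly p)"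
    using Suc.hyps(2) by (simp add: constant_degree)
  then obtain r where r: "poly p r = 0"
    using fundamental_theorem_of_algebra by blast
  then obtain q where pq: "p = [:-r, 1:] * q"
    by (metis dvdE poly_eq_0_iff_dvd)
  have q0: "q \<noteq> 0" using Suc.hyps(2) pq by auto
  have dq: "degree p = Suc (degree q)" using q0 unfolding pq by (subst degree_mult_eq) auto
  have "lead_coeff p = lead_coeff q" unfolding pq lead_coeff_mult by simp
  moreover have "norm (lead_coeff q) * s ^ degree q \<le> norm (poly q a)"
    using Suc.hyps dq Suc.prems pq by auto
  moreover have "poly p a = (a - r) * poly q a" unfolding pq by (simp add: algebra_simps)
  ultimately have "norm (lead_coeff p) * s ^ degree p = s * (norm (lead_coeff q) * s ^ degree q)"
    using dq by simp
  also have "\<dots> \<le> norm (a - r) * norm (poly q a)"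
    using \<open>norm (lead_coeff q) * s ^ degree q \<le> norm (poly q a)\<close> Suc.prems[OF r] assms(2)
    by (intro mult_mono) auto
  finally show ?case using \<open>poly p a = _\<close> by (simp add: norm_mult)
qed

section \<open>Alternating binomial polynomials and their roots in the unit disc\<close>

text \<open>The decimated polynomial is \<open>alt_binom_poly (d + 1) c\<close> where \<open>c\<close> lists the data. Dependence on \<open>c\<close>
  is linear, so the exact data and the noise can be treated separately; and the value at \<open>1\<close> is,
  up to sign, the \<open>n\<close>-th finite difference of \<open>c\<close>.\<close>
definition alt_binom_poly :: "nat \<Rightarrow> (nat \<Rightarrow> complex) \<Rightarrow> complex poly" where
  "alt_binom_poly n c = (\<Sum>j\<le>n. monom ((-1) ^ j * of_nat (n choose j) * c j) (n - j))"

lemma poly_alt_binom_poly: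
  "poly (alt_binom_poly n c) v = (\<Sum>j\<le>n. (-1) ^ j * of_nat (n choose j) * c j * v ^ (n - j))"
  by (simp add: alt_binom_poly_def poly_sum poly_monom)

lemma coeff_alt_binom_poly:
  "coeff (alt_binom_poly n c) n = c 0"
proof -
  have "coeff (alt_binom_poly n c) n =
      (\<Sum>j\<le>n. if j = 0 then (-1) ^ j * of_nat (n choose j) * c j else 0)"
    unfolding alt_binom_poly_def coeff_sum by (rule sum.cong) auto
  then show ?thesis by simp
qed

lemma degree_alt_binom_poly_le: "degree (alt_binom_poly n c) \<le> n"
  unfolding alt_binom_poly_def
  by (intro degree_sum_le) (auto intro: order.trans[OF degree_monom_le])

lemma alt_binom_poly_power_0: "alt_binom_poly n (\<lambda>j. of_nat (j + 1) ^ 0) = [:-1, 1:] ^ n"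
proof -
  have "poly (alt_binom_poly n (\<lambda>j. of_nat (j + 1) ^ 0)) z = poly ([:-1, 1:] ^ n) z" for z
  proof -
    have "poly ([:-1, 1:] ^ n) z = (-1 + z) ^ n" by (simp add: poly_power)
    also have "\<dots> = (\<Sum>k\<le>n. of_nat (n choose k) * (-1) ^ k * z ^ (n - k))"
      by (rule binomial_ring)
    finally show ?thesis
      by (simp add: poly_alt_binom_poly mult_ac)
  qed
  then show ?thesis by (metis poly_eq_poly_eq_iff ext)
qed

text \<open>On \<open>v ^ (n - j)\<close> the operator \<open>p \<mapsto> (n + 1) * p - v * p'\<close> acts as multiplication by \<open>j + 1\<close>. So the
  polynomials with data \<open>(j + 1) ^ l\<close> arise from \<open>(v - 1) ^ n\<close> by iterating this operator.\<close>
lemma alt_binom_poly_power_Suc: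
  "alt_binom_poly n (\<lambda>j. of_nat (j + 1) ^ Suc l) =
     smult (of_nat (n + 1)) (alt_binom_poly n (\<lambda>j. of_nat (j + 1) ^ l)) -
     [:0, 1:] * pderiv (alt_binom_poly n (\<lambda>j. of_nat (j + 1) ^ l))"
proof -
  have smult_sum: "smult c (sum f A) = (\<Sum>x\<in>A. smult c (f x))"
    for c :: complex and f :: "nat \<Rightarrow> complex poly" and A
    by (induction A rule: infinite_finite_induct) (simp_all add: smult_add_right)
  have X: "[:0, 1:] * pderiv (monom c k) = monom (of_nat k * c) k" for c :: complex and k
    by (cases k) (auto simp: pderiv_monom mult_monom simp flip: monom_Suc)
  have "smult (of_nat (n + 1)) (alt_binom_poly n (\<lambda>j. of_nat (j + 1) ^ l)) -
     [:0, 1:] * pderiv (alt_binom_poly n (\<lambda>j. of_nat (j + 1) ^ l)) =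
     (\<Sum>j\<le>n. smult (of_nat (n + 1)) (monom ((-1) ^ j * of_nat (n choose j) * of_nat (j + 1) ^ l) (n - j)) -
       [:0, 1:] * pderiv (monom ((-1) ^ j * of_nat (n choose j) * of_nat (j + 1) ^ l) (n - j)))"
    unfolding alt_binom_poly_def smult_sum higher_pderiv_sum[where n=1, simplified]
    by (simp add: sum_subtractf sum_distrib_left)
  also have "\<dots> = alt_binom_poly n (\<lambda>j. of_nat (j + 1) ^ Suc l)"
    unfolding alt_binom_poly_def
  proof (rule sum.cong)
    fix j assume "j \<in> {..n}"
    then have "of_nat (n + 1) - of_nat (n - j) = (of_nat (j + 1) :: complex)"
      by (simp add: of_nat_diff)
    then have *: "of_nat (n + 1) * c - of_nat (n - j) * c = of_nat (j + 1) * c" for c :: complex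
      by (metis left_diff_distrib)
    then show "smult (of_nat (n + 1)) (monom ((-1) ^ j * of_nat (n choose j) * of_nat (j + 1) ^ l) (n - j)) -
       [:0, 1:] * pderiv (monom ((-1) ^ j * of_nat (n choose j) * of_nat (j + 1) ^ l) (n - j)) =
       (monom ((-1) ^ j * of_nat (n choose j) * of_nat (j + 1) ^ Suc l) (n - j) :: complex poly)"
      unfolding X smult_monom diff_monom * power_Suc by (simp only: mult_ac)
  qed simp
  finally show ?thesis ..
qed

text \<open>Each application of the operator lowers the multiplicity of the root \<open>1\<close> by one. It creates no new
  root in the closed unit disc: off \<open>1\<close>, the quotient of the new polynomial by the old one is \<open>n + 1 - v * p' / p\<close>
  with \<open>p\<close> the old one. Its real part is at least \<open>n + 1 - n / 2\<close>, since none of the at most \<open>n\<close> roots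
  of \<open>p\<close> lies in the open disc.\<close>
lemma alt_binom_poly_power_factor:
  assumes "l \<le> n"
  shows "\<exists>g. alt_binom_poly n (\<lambda>j. of_nat (j + 1) ^ l) = [:-1, 1:] ^ (n - l) * g \<and>
    degree g \<le> l \<and> (\<forall>v. norm v \<le> 1 \<longrightarrow> poly g v \<noteq> 0)"
  using assms
proof (induction l)
  case 0
  show ?case by (rule exI[of _ 1]) (simp only: alt_binom_poly_power_0, simp)
next
  case (Suc l)
  then obtain g where g: "alt_binom_poly n (\<lambda>j. of_nat (j + 1) ^ l) = [:-1, 1:] ^ (n - l) * g"
    "degree g \<le> l" "\<And>v. norm v \<le> 1 \<Longrightarrow> poly g v \<noteq> 0" by auto
  define k where "k = n - Suc l"
  have k: "n - l = Suc k" using Suc.prems by (simp add: k_def)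
  define h where "h = smult (of_nat (n + 1)) ([:-1, 1:] * g) - [:0, 1:] * (smult (of_nat (Suc k)) g + [:-1, 1:] * pderiv g)"
  have "pderiv ([:-1, 1:] ^ Suc k :: complex poly) = smult (of_nat (Suc k)) ([:-1, 1:] ^ k)"
    by (simp add: pderiv_power_Suc pderiv_pCons del: power_Suc)
  then have factor: "alt_binom_poly n (\<lambda>j. of_nat (j + 1) ^ Suc l) = [:-1, 1:] ^ k * h"
    unfolding alt_binom_poly_power_Suc g(1) k h_def pderiv_mult
    by (simp add: algebra_simps del: mult_pCons_left mult_pCons_right of_nat_Suc of_nat_add
        flip: smult_add_right)
  have "degree ([:-1, 1:] * pderiv g) \<le> l"
  proof (cases "degree g = 0")
    case True
    then have "pderiv g = 0" by (simp add: pderiv_eq_0_iff)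
    then show ?thesis by simp
  next
    case False
    then show ?thesis
      using g(2) degree_mult_le[of "[:-1, 1:]" "pderiv g"] by (simp add: degree_pderiv del: mult_pCons_left)
  qed
  then have "degree (smult (of_nat (Suc k)) g + [:-1, 1:] * pderiv g) \<le> l"
    using g(2) by (intro degree_add_le order.trans[OF degree_smult_le])
  then have "degree ([:0, 1:] * (smult (of_nat (Suc k)) g + [:-1, 1:] * pderiv g)) \<le> Suc l"
    by (intro order.trans[OF degree_mult_le]) simp
  moreover have "degree (smult (of_nat (n + 1)) ([:-1, 1:] * g)) \<le> Suc l"
    using g(2) by (intro order.trans[OF degree_smult_le] order.trans[OF degree_mult_le]) simp
  ultimately have "degree h \<le> Suc l"
    unfolding h_def by (intro degree_diff_le)
  moreover have "poly h v \<noteq> 0" if v: "norm v \<le> 1" for v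
  proof (cases "v = 1")
    case True
    then show ?thesis using g(3)[of 1] by (simp add: h_def del: of_nat_Suc)
  next
    case False
    \<comment> \<open>\<open>L\<close> is the quotient of the new polynomial by the old one; \<open>h\<close> is the former with \<open>(v - 1) ^ k\<close> cancelled.\<close>
    define L where "L = of_nat (n + 1) - of_nat (Suc k) * (v / (v - 1)) - v * poly (pderiv g) v / poly g v"
    have gv: "poly g v \<noteq> 0" using g(3) v by simp
    have "poly h v = (v - 1) * poly g v * L"
      using False gv unfolding h_def L_def
      by (simp add: field_simps del: of_nat_Suc of_nat_add)
    moreover have "Re L > 0"
    proof -
      have "Re (v * poly (pderiv g) v / poly g v) \<le> l / 2"
        using Re_log_deriv_le_half_degree[of g v] g(2,3) v by fastforce
      moreover have "Re (of_nat (Suc k) * (v / (v - 1))) \<le> Suc k * (1 / 2)"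
      proof -
        have "Re (of_nat (Suc k) * (v / (v - 1))) = real (Suc k) * Re (v / (v - 1))"
          by (simp only: times_complex.sel complex_Re_of_nat complex_Im_of_nat mult_zero_left diff_zero)
        moreover have "Re (v / (v - 1)) \<le> 1 / 2"
          using v False by (intro Re_div_diff_le_half) auto
        then have "real (Suc k) * Re (v / (v - 1)) \<le> Suc k * (1 / 2)"
          by (rule mult_left_mono) simp
        ultimately show ?thesis by (simp only:)
      qed
      moreover have "real n = real (Suc k) + real l" using k Suc.prems by linarith
      ultimately show ?thesis unfolding L_def by (simp del: of_nat_Suc)
    qed
    ultimately show ?thesis using False gv by auto
  qed
  ultimately show ?case using factor unfolding k_def by blast
qed

section \<open>The root closest to the unit circle under perturbation\<close>

text \<open>The factor \<open>norm (v - 1)\<close> on the right is what lets the difference between the exact and the limit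
  polynomial be absorbed into the lower bound for the latter.\<close>
lemma norm_power_diff_1_le:
  fixes v :: complex
  assumes "norm v \<le> 2"
  shows "norm (v ^ k - 1) \<le> real k * 2 ^ k * norm (v - 1)"
proof (induction k)
  case 0
  show ?case by simp
next
  case (Suc k)
  have "v ^ Suc k - 1 = v * (v ^ k - 1) + (v - 1)" by (simp add: algebra_simps)
  then have "norm (v ^ Suc k - 1) \<le> norm v * norm (v ^ k - 1) + norm (v - 1)"
    by (metis norm_mult norm_triangle_ineq)
  also have "\<dots> \<le> 2 * (real k * 2 ^ k * norm (v - 1)) + 2 ^ Suc k * norm (v - 1)"
    using Suc assms one_le_power[of "2 :: real" "Suc k"]
    by (intro add_mono mult_mono) (auto simp: mult_le_cancel_right1)
  finally show ?case by (simp add: algebra_simps)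
qed

lemma norm_alt_binom_sum_le:
  fixes f :: "nat \<Rightarrow> complex"
  assumes "\<And>j. j \<le> n \<Longrightarrow> norm (f j) \<le> b"
  shows "norm (\<Sum>j\<le>n. (-1) ^ j * of_nat (n choose j) * f j) \<le> 2 ^ n * b"
proof -
  have "norm (\<Sum>j\<le>n. (-1) ^ j * of_nat (n choose j) * f j) \<le> (\<Sum>j\<le>n. real (n choose j) * b)"
    using assms by (intro sum_norm_le) (auto simp: norm_mult norm_power intro: mult_left_mono)
  also have "\<dots> = real (\<Sum>j\<le>n. n choose j) * b" by (simp add: sum_distrib_right)
  finally show ?thesis by (simp add: choose_row_sum)
qed

text \<open>An \<open>n\<close>-th finite difference annihilates polynomials of degree less than \<open>n\<close>; here it is the
  statement that \<open>1\<close> is a root of \<open>alt_binom_poly n (\<lambda>j. (j + 1) ^ l)\<close>.\<close>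
lemma alt_binom_sum_power_eq_0:
  assumes "l < n"
  shows "(\<Sum>j\<le>n. (-1) ^ j * of_nat (n choose j) * of_nat (j + 1) ^ l) = (0 :: complex)"
proof -
  obtain g where "alt_binom_poly n (\<lambda>j. of_nat (j + 1) ^ l) = [:-1, 1:] ^ (n - l) * g"
    using alt_binom_poly_power_factor[of l n] assms by auto
  then have "poly (alt_binom_poly n (\<lambda>j. of_nat (j + 1) ^ l)) 1 = 0"
    using assms by simp
  then show ?thesis by (simp add: poly_alt_binom_poly)
qed

text \<open>For \<open>l = d = n - 1\<close> the root \<open>1\<close> is simple and the finitely many others stay off a disc slightly
  larger than the unit disc, where the cofactor of \<open>v - 1\<close> is therefore bounded away from \<open>0\<close>.\<close>
lemma alt_binom_poly_power_lower_bound: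
  obtains \<eta> c :: real where "0 < \<eta>" "\<eta> \<le> 1" "0 < c"
    "\<And>v. norm v \<le> 1 + \<eta> \<Longrightarrow>
       c * norm (v - 1) \<le> norm (poly (alt_binom_poly (d + 1) (\<lambda>j. of_nat (j + 1) ^ d)) v)"
proof -
  obtain g where g: "alt_binom_poly (d + 1) (\<lambda>j. of_nat (j + 1) ^ d) = [:-1, 1:] * g"
      "\<And>v. norm v \<le> 1 \<Longrightarrow> poly g v \<noteq> 0"
    using alt_binom_poly_power_factor[of d "d + 1"] by auto
  define M where "M = Min (insert 2 (norm ` {r. poly g r = 0}))"
  have "g \<noteq> 0" using g(2)[of 0] by auto
  then have fin: "finite {r. poly g r = 0}" by (rule poly_roots_finite)
  have M: "1 < M" "M \<le> 2" and Mr: "\<And>r. poly g r = 0 \<Longrightarrow> M \<le> norm r"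
    unfolding M_def using fin g(2) by (force, auto)
  define \<eta> where "\<eta> = (M - 1) / 2"
  have \<eta>: "0 < \<eta>" "\<eta> \<le> 1" "1 + \<eta> < M" using M by (auto simp: \<eta>_def field_simps)
  have "\<exists>x\<in>cball 0 (1 + \<eta>). \<forall>y\<in>cball 0 (1 + \<eta>). norm (poly g x) \<le> norm (poly g y)"
    using \<eta> by (intro continuous_attains_inf) (auto intro!: continuous_intros)
  then obtain x where x: "norm x \<le> 1 + \<eta>" "\<And>y. norm y \<le> 1 + \<eta> \<Longrightarrow> norm (poly g x) \<le> norm (poly g y)"
    by auto
  have "poly g x \<noteq> 0" using x(1) \<eta>(3) Mr[of x] by auto
  show ?thesis
  proof (rule that[of \<eta> "norm (poly g x)"])
    fix v :: complex assume v: "norm v \<le> 1 + \<eta>"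
    have "poly (alt_binom_poly (d + 1) (\<lambda>j. of_nat (j + 1) ^ d)) v = (v - 1) * poly g v"
      unfolding g(1) by (simp add: algebra_simps)
    then show "norm (poly g x) * norm (v - 1) \<le>
        norm (poly (alt_binom_poly (d + 1) (\<lambda>j. of_nat (j + 1) ^ d)) v)"
      using x(2)[OF v] by (simp add: norm_mult mult.commute mult_left_mono)
  qed (use \<eta> \<open>poly g x \<noteq> 0\<close> in auto)
qed

text \<open>The data are \<open>x + y\<close>, where \<open>x\<close> is exact (its alternating sum vanishes, so \<open>1\<close> is a root for it) and close
  to its large-\<open>N\<close> limit \<open>(j + 1) ^ d\<close>, and \<open>y\<close> is noise of size \<open>\<tau>\<close>. The closeness parameter \<open>\<epsilon>\<close>
  does not enter the error bound: since \<open>1\<close> is a root for \<open>x\<close> and for the limit alike, their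
  polynomials differ at \<open>z\<close> by at most a small multiple of \<open>norm (z - 1)\<close>.\<close>
lemma alt_binom_poly_closest_root:
  obtains \<epsilon> C :: real where "0 < \<epsilon>" "0 < C"
    "\<And>x y \<tau>. \<lbrakk>\<And>j. j \<le> d + 1 \<Longrightarrow> norm (x j - of_nat (j + 1) ^ d) \<le> \<epsilon>;
        (\<Sum>j\<le>d + 1. (-1) ^ j * of_nat (d + 1 choose j) * x j) = 0;
        \<And>j. j \<le> d + 1 \<Longrightarrow> norm (y j) \<le> \<tau>; \<tau> \<le> \<epsilon>\<rbrakk> \<Longrightarrow>
      alt_binom_poly (d + 1) (\<lambda>j. x j + y j) \<noteq> 0 \<and>
      (\<exists>v. poly (alt_binom_poly (d + 1) (\<lambda>j. x j + y j)) v = 0) \<and>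
      (\<forall>z. poly (alt_binom_poly (d + 1) (\<lambda>j. x j + y j)) z = 0 \<longrightarrow>
         (\<forall>v. poly (alt_binom_poly (d + 1) (\<lambda>j. x j + y j)) v = 0 \<longrightarrow>
              \<bar>norm z - 1\<bar> \<le> \<bar>norm v - 1\<bar>) \<longrightarrow>
         norm (z - 1) \<le> C * \<tau>)"
proof -
  define n where "n = d + 1"
  obtain \<eta> c :: real where \<eta>: "0 < \<eta>" "\<eta> \<le> 1" and c: "0 < c" and
    E: "\<And>v. norm v \<le> 1 + \<eta> \<Longrightarrow>
       c * norm (v - 1) \<le> norm (poly (alt_binom_poly n (\<lambda>j. of_nat (j + 1) ^ d)) v)"
    by (fact alt_binom_poly_power_lower_bound[of d, folded n_def])
  define K where "K = 2 ^ n * (real n * 2 ^ n)"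
  have K: "0 < K" by (simp add: K_def n_def)
  \<comment> \<open>The three bounds keep the leading coefficient above \<open>1 / 2\<close>, make the error of \<open>x\<close> absorb into
    half of the lower bound \<open>c\<close>, and force a root within distance \<open>\<eta>\<close> of \<open>1\<close>.\<close>
  define \<epsilon> where "\<epsilon> = min (1 / 4) (min (c / (2 * K)) (\<eta> ^ n / 2 ^ (n + 2)))"
  have \<epsilon>: "0 < \<epsilon>" "\<epsilon> \<le> 1 / 4" "\<epsilon> * K \<le> c / 2" "2 ^ n * \<epsilon> \<le> \<eta> ^ n / 4"
  proof -
    show "0 < \<epsilon>" "\<epsilon> \<le> 1 / 4" using c K \<eta> by (auto simp: \<epsilon>_def)
    have "\<epsilon> \<le> c / (2 * K)" "\<epsilon> \<le> \<eta> ^ n / 2 ^ (n + 2)" by (auto simp: \<epsilon>_def)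
    then show "\<epsilon> * K \<le> c / 2" "2 ^ n * \<epsilon> \<le> \<eta> ^ n / 4"
      using K by (auto simp: field_simps)
  qed
  show ?thesis
  proof (rule that[of \<epsilon> "2 * (2 ^ n * 2 ^ n) / c"], fold n_def)
    fix x y :: "nat \<Rightarrow> complex" and \<tau> :: real
    assume x: "\<And>j. j \<le> n \<Longrightarrow> norm (x j - of_nat (j + 1) ^ d) \<le> \<epsilon>"
      and x0: "(\<Sum>j\<le>n. (-1) ^ j * of_nat (n choose j) * x j) = 0"
      and y: "\<And>j. j \<le> n \<Longrightarrow> norm (y j) \<le> \<tau>" and \<tau>: "\<tau> \<le> \<epsilon>"
    define q where "q = alt_binom_poly n (\<lambda>j. x j + y j)"
    define E where "E = alt_binom_poly n (\<lambda>j. of_nat (j + 1) ^ d)"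
    have "coeff q n = 1 + (x 0 - 1) + y 0" by (simp add: q_def coeff_alt_binom_poly)
    moreover have "norm (x 0 - 1) \<le> 1 / 4" "norm (y 0) \<le> 1 / 4"
      using x[of 0] y[of 0] \<tau> \<epsilon> by auto
    moreover have "norm (1 + (x 0 - 1) + y 0) \<ge> norm (1 + (x 0 - 1)) - norm (y 0)"
      by (rule norm_diff_ineq)
    moreover have "norm (1 + (x 0 - 1)) \<ge> norm (1 :: complex) - norm (x 0 - 1)"
      by (rule norm_diff_ineq)
    ultimately have lead: "1 / 2 \<le> norm (coeff q n)"
      by simp
    then have nz: "coeff q n \<noteq> 0" by auto
    then have q0: "q \<noteq> 0" by auto
    have "degree q \<le> n" unfolding q_def by (rule degree_alt_binom_poly_le)
    then have deg: "degree q = n" using le_degree[OF nz] by (rule le_antisym)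
    have small: "\<exists>v. poly q v = 0 \<and> norm (1 - v) < \<eta>"
    proof (rule ccontr)
      assume "\<not> ?thesis"
      then have "norm (lead_coeff q) * \<eta> ^ degree q \<le> norm (poly q 1)"
        using \<eta> by (intro norm_poly_ge_root_dist) (auto simp: not_less)
      moreover have "poly q 1 = (\<Sum>j\<le>n. (-1) ^ j * of_nat (n choose j) * y j)"
        using x0 by (simp add: q_def poly_alt_binom_poly ring_distribs sum.distrib)
      then have "norm (poly q 1) \<le> 2 ^ n * \<tau>"
        using norm_alt_binom_sum_le[of n y \<tau>] y by simp
      moreover have "2 ^ n * \<tau> \<le> 2 ^ n * \<epsilon>" using \<tau> by simp
      moreover have "1 / 2 * \<eta> ^ n \<le> norm (lead_coeff q) * \<eta> ^ degree q"
        using lead deg \<eta> by (intro mult_mono) auto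
      moreover have "\<eta> ^ n > 0" using \<eta> by simp
      ultimately show False using \<epsilon>(4) by linarith
    qed
    have "norm (z - 1) \<le> 2 * (2 ^ n * 2 ^ n) / c * \<tau>"
      if z: "poly q z = 0" and closest: "\<And>v. poly q v = 0 \<Longrightarrow> \<bar>norm z - 1\<bar> \<le> \<bar>norm v - 1\<bar>" for z
    proof -
      obtain v where "poly q v = 0" "norm (1 - v) < \<eta>" using small by auto
      then have "\<bar>norm z - 1\<bar> \<le> \<bar>norm v - 1\<bar>" "\<bar>norm v - 1\<bar> \<le> \<eta>"
        using closest norm_triangle_ineq3[of v 1] by (auto simp: norm_minus_commute)
      then have nz: "norm z \<le> 1 + \<eta>" by linarith
      then have nz2: "norm z \<le> 2" using \<eta> by simp
      have zk: "norm (z ^ (n - j)) \<le> 2 ^ n" for j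
      proof -
        have "norm (z ^ (n - j)) \<le> 2 ^ (n - j)"
          using nz2 by (simp add: norm_power power_mono)
        also have "\<dots> \<le> 2 ^ n" by (simp add: power_increasing)
        finally show ?thesis .
      qed
      \<comment> \<open>Both \<open>x\<close> and its limit have vanishing alternating sum, so \<open>z ^ (n - j)\<close> may be replaced by
        \<open>z ^ (n - j) - 1\<close> below.\<close>
      have t0: "(\<Sum>j\<le>n. (-1) ^ j * of_nat (n choose j) * (x j - of_nat (j + 1) ^ d)) = 0"
        using x0 alt_binom_sum_power_eq_0[of d n]
        by (simp add: right_diff_distrib sum_subtractf n_def)
      have "poly q z = poly E z +
          (\<Sum>j\<le>n. (-1) ^ j * of_nat (n choose j) * ((x j - of_nat (j + 1) ^ d) * z ^ (n - j))) +
          (\<Sum>j\<le>n. (-1) ^ j * of_nat (n choose j) * (y j * z ^ (n - j)))"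
        unfolding q_def E_def poly_alt_binom_poly sum.distrib[symmetric]
        by (intro sum.cong) (auto simp: algebra_simps)
      also have "(\<Sum>j\<le>n. (-1) ^ j * of_nat (n choose j) * ((x j - of_nat (j + 1) ^ d) * z ^ (n - j))) =
          (\<Sum>j\<le>n. (-1) ^ j * of_nat (n choose j) * ((x j - of_nat (j + 1) ^ d) * (z ^ (n - j) - 1)))"
      proof -
        have "(\<Sum>j\<le>n. (-1) ^ j * of_nat (n choose j) * ((x j - of_nat (j + 1) ^ d) * z ^ (n - j))) =
            (\<Sum>j\<le>n. (-1) ^ j * of_nat (n choose j) * ((x j - of_nat (j + 1) ^ d) * (z ^ (n - j) - 1))) +
            (\<Sum>j\<le>n. (-1) ^ j * of_nat (n choose j) * (x j - of_nat (j + 1) ^ d))"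
          unfolding sum.distrib[symmetric] by (intro sum.cong) (auto simp: algebra_simps)
        then show ?thesis unfolding t0 by simp
      qed
      finally have eq: "poly E z = -
          (\<Sum>j\<le>n. (-1) ^ j * of_nat (n choose j) * ((x j - of_nat (j + 1) ^ d) * (z ^ (n - j) - 1))) -
          (\<Sum>j\<le>n. (-1) ^ j * of_nat (n choose j) * (y j * z ^ (n - j)))"
        using z by (simp add: algebra_simps eq_neg_iff_add_eq_0)
      have "norm (\<Sum>j\<le>n. (-1) ^ j * of_nat (n choose j) * ((x j - of_nat (j + 1) ^ d) * (z ^ (n - j) - 1)))
          \<le> 2 ^ n * (\<epsilon> * (real n * 2 ^ n * norm (z - 1)))"
      proof (rule norm_alt_binom_sum_le)
        fix j assume j: "j \<le> n"
        have "norm (z ^ (n - j) - 1) \<le> real (n - j) * 2 ^ (n - j) * norm (z - 1)"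
          by (rule norm_power_diff_1_le[OF nz2])
        also have "\<dots> \<le> real n * 2 ^ n * norm (z - 1)"
          by (intro mult_mono) (auto simp: power_increasing)
        finally show "norm ((x j - of_nat (j + 1) ^ d) * (z ^ (n - j) - 1))
            \<le> \<epsilon> * (real n * 2 ^ n * norm (z - 1))"
          unfolding norm_mult using x[OF j] \<epsilon>(1) by (intro mult_mono) auto
      qed
      moreover have "norm (\<Sum>j\<le>n. (-1) ^ j * of_nat (n choose j) * (y j * z ^ (n - j))) \<le> 2 ^ n * (\<tau> * 2 ^ n)"
      proof (rule norm_alt_binom_sum_le)
        fix j assume "j \<le> n"
        then show "norm (y j * z ^ (n - j)) \<le> \<tau> * 2 ^ n"
          unfolding norm_mult using y zk[of j] by (intro mult_mono) (auto intro: order.trans[OF norm_ge_zero])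
      qed
      moreover have "norm (- a - b) \<le> norm a + norm b" for a b :: complex
        using norm_triangle_ineq4[of "- a" b] by simp
      moreover have "c * norm (z - 1) \<le> norm (poly E z)" unfolding E_def using nz by (rule E)
      ultimately have "c * norm (z - 1) \<le> 2 ^ n * (\<epsilon> * (real n * 2 ^ n * norm (z - 1))) + 2 ^ n * (\<tau> * 2 ^ n)"
        unfolding eq by (meson add_mono order.trans)
      also have "2 ^ n * (\<epsilon> * (real n * 2 ^ n * norm (z - 1))) = (\<epsilon> * K) * norm (z - 1)"
        by (simp add: K_def)
      also have "\<dots> \<le> c / 2 * norm (z - 1)" using \<epsilon>(3) by (intro mult_right_mono) auto
      finally show ?thesis using c by (simp add: field_simps)
    qed
    then show "alt_binom_poly n (\<lambda>j. x j + y j) \<noteq> 0 \<and>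
      (\<exists>v. poly (alt_binom_poly n (\<lambda>j. x j + y j)) v = 0) \<and>
      (\<forall>z. poly (alt_binom_poly n (\<lambda>j. x j + y j)) z = 0 \<longrightarrow>
         (\<forall>v. poly (alt_binom_poly n (\<lambda>j. x j + y j)) v = 0 \<longrightarrow>
              \<bar>norm z - 1\<bar> \<le> \<bar>norm v - 1\<bar>) \<longrightarrow>
         norm (z - 1) \<le> 2 * (2 ^ n * 2 ^ n) / c * \<tau>)"
      using q0 small unfolding q_def by blast
  qed (use \<epsilon> c in auto)
qed

section \<open>Selecting the N-th root and its argument\<close>

text \<open>If \<open>\<zeta>\<close> were closer to \<open>1\<close>, the vanishing sum of \<open>1, \<zeta>, \<dots>, \<zeta> ^ (N - 1)\<close> would consist of terms too
  close to \<open>1\<close>.\<close>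
lemma norm_root_of_unity_minus_1_ge:
  fixes \<zeta> :: complex
  assumes "\<zeta> ^ N = 1" "\<zeta> \<noteq> 1" "N > 0"
  shows "1 / real N \<le> norm (\<zeta> - 1)"
proof -
  have "norm \<zeta> ^ N = 1 ^ N" using assms(1) by (metis norm_one norm_power power_one)
  then have n1: "norm \<zeta> = 1" using assms(3) by (subst (asm) power_eq_iff_eq_base) auto
  have "(\<Sum>k<N. \<zeta> ^ k) = 0" using assms by (simp add: geometric_sum)
  then have "real N = norm (\<Sum>k<N. \<zeta> ^ k - 1)"
    by (simp add: sum_subtractf)
  also have "\<dots> \<le> (\<Sum>k<N. real N * norm (\<zeta> - 1))"
  proof (rule sum_norm_le)
    fix k assume "k \<in> {..<N}"
    then have "real k * norm (\<zeta> - 1) \<le> real N * norm (\<zeta> - 1)" by (intro mult_right_mono) auto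
    then show "norm (\<zeta> ^ k - 1) \<le> real N * norm (\<zeta> - 1)"
      using norm_power_diff[of \<zeta> 1 k] n1 by simp
  qed
  finally show ?thesis using assms(3) by (simp add: field_simps)
qed

lemma norm_exp_minus_1_le:
  fixes y :: complex
  assumes "norm y \<le> 1 / 2"
  shows "norm (exp y - 1) \<le> 2 * norm y"
proof -
  have "norm (exp y - 1) \<le> exp (norm y) * norm y"
    using Taylor_exp_field[of y 0] by simp
  also have "\<dots> \<le> 2 * norm y"
    using exp_bound_half[of "norm y"] assms by (intro mult_right_mono) auto
  finally show ?thesis .
qed

lemma norm_exp_i_diff_le:
  "norm (exp (- \<i> * of_real x) - exp (- \<i> * of_real y)) \<le> \<bar>x - y\<bar>"
proof -
  have "exp (- \<i> * of_real x) - exp (- \<i> * of_real y) =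
      exp (\<i> * of_real (- y)) * (exp (\<i> * of_real (y - x)) - 1)"
    by (simp add: right_diff_distrib flip: exp_add)
  then have "norm (exp (- \<i> * of_real x) - exp (- \<i> * of_real y)) = norm (exp (\<i> * of_real (y - x)) - 1)"
    by (simp only: norm_mult norm_exp_i_times mult_1_left)
  also have "\<dots> \<le> \<bar>x - y\<bar>"
    unfolding dist_exp_i_1 using abs_sin_x_le_abs_x[of "(y - x) / 2"] by simp
  finally show ?thesis .
qed

text \<open>Here \<open>\<zeta>\<close> is the ratio of the computed \<open>N\<close>-th power to the true one. One of the \<open>N\<close>-th roots is
  \<open>exp (- \<i> * \<xi> + Ln \<zeta> / N)\<close>, so the error \<open>\<zeta> - 1\<close> is divided by \<open>N\<close>. This is where decimation gains a power of \<open>N\<close>. The other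
  candidates are at distance about \<open>1 / N\<close> or more from this one, which exceeds the total of root error and
  a-priori error, so that the algorithm cannot select them.\<close>
lemma closest_nth_root:
  assumes N: "N > 0" and \<omega>: "\<omega> ^ N = exp (- \<i> * of_real \<xi>) ^ N * \<zeta>"
    and \<zeta>: "norm (\<zeta> - 1) \<le> 1 / 32" and \<xi>0: "\<bar>\<xi>0 - \<xi>\<bar> \<le> 1 / (8 * real N)"
    and closest: "\<And>w. w ^ N = exp (- \<i> * of_real \<xi>) ^ N * \<zeta> \<Longrightarrow>
      dist \<omega> (exp (- \<i> * of_real \<xi>0)) \<le> dist w (exp (- \<i> * of_real \<xi>0))"
  obtains y where "\<omega> = exp (- \<i> * of_real \<xi> + y)" "norm y \<le> 2 * norm (\<zeta> - 1) / real N"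
proof -
  define y where "y = Ln \<zeta> / of_nat N"
  define w where "w = exp (- \<i> * of_real \<xi> + y)"
  define e where "e = exp (- \<i> * of_real \<xi>)"
  define e0 where "e0 = exp (- \<i> * of_real \<xi>0)"
  have "\<zeta> \<noteq> 0" using \<zeta> by auto
  have "norm (Ln (1 + (\<zeta> - 1))) \<le> 2 * norm (\<zeta> - 1)"
    using \<zeta> by (intro norm_Ln_le) auto
  then have y: "norm y \<le> 2 * norm (\<zeta> - 1) / real N"
    using N by (simp add: y_def norm_divide divide_right_mono)
  have "2 * norm (\<zeta> - 1) / real N \<le> (1 / 16) / real N"
    using \<zeta> by (intro divide_right_mono) auto
  then have yN: "norm y \<le> (1 / 16) / real N" using y by linarith
  have "(1 / 16) / real N \<le> 1 / 16" using N by (simp add: field_simps)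
  then have y16: "norm y \<le> 1 / 16" using yN by linarith
  have we: "w = e * exp y" by (simp only: w_def e_def exp_add)
  have "exp y ^ N = \<zeta>"
    using N \<open>\<zeta> \<noteq> 0\<close> by (simp add: y_def flip: exp_of_nat_mult)
  then have wN: "w ^ N = e ^ N * \<zeta>" by (simp add: we power_mult_distrib)
  have ne: "norm e = 1" unfolding e_def using norm_exp_i_times[of "- \<xi>"] by simp
  have exp1: "norm (exp y - 1) \<le> 2 * norm y" using y16 by (intro norm_exp_minus_1_le) simp
  have "w - e = e * (exp y - 1)" unfolding we by (simp add: right_diff_distrib)
  then have "norm (w - e) = norm (exp y - 1)"
    using ne by (simp add: norm_mult)
  moreover have "norm (e - e0) \<le> 1 / (8 * real N)"
    using norm_exp_i_diff_le[of \<xi> \<xi>0] \<xi>0 unfolding e_def e0_def by linarith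
  ultimately have dw: "dist w e0 \<le> (1 / 4) / real N"
    using exp1 yN norm_triangle_ineq[of "w - e" "e - e0"] by (simp add: dist_norm)
  have "dist \<omega> e0 \<le> dist w e0"
    using closest wN unfolding e_def e0_def by simp
  then have d: "norm (\<omega> - w) \<le> (1 / 2) / real N"
    using dw dist_triangle2[of \<omega> w e0] by (simp add: dist_norm)
  have nw: "3 / 4 \<le> norm w"
    using norm_triangle_ineq2[of 1 "exp y"] norm_minus_commute[of 1 "exp y"] exp1 y16 ne
    by (simp add: we norm_mult del: norm_exp_eq_Re)
  have "\<omega> = w"
  proof (rule ccontr)
    assume neq: "\<omega> \<noteq> w"
    have w0: "w \<noteq> 0" by (simp add: w_def)
    have "(\<omega> / w) ^ N = 1"
      using wN \<omega> w0 \<open>\<zeta> \<noteq> 0\<close> unfolding power_divide e_def by simp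
    then have "1 / real N \<le> norm (\<omega> / w - 1)"
      using neq w0 N by (intro norm_root_of_unity_minus_1_ge) auto
    also have "\<omega> / w - 1 = (\<omega> - w) / w" using w0 by (simp add: field_simps)
    finally have "norm w * (1 / real N) \<le> norm (\<omega> - w)"
      using w0 by (simp add: norm_divide field_simps)
    moreover have "3 / 4 * (1 / real N) \<le> norm w * (1 / real N)" using nw by (intro mult_right_mono) auto
    ultimately have "3 / 4 * (1 / real N) \<le> (1 / 2) / real N" using d by linarith
    then show False using N by (simp add: field_simps)
  qed
  then show ?thesis using that[of y] y unfolding w_def by simp
qed

text \<open>The arguments of \<open>\<omega>\<close> are \<open>2 * pi\<close> apart, and \<open>\<xi> - Im y\<close> is one candidate that lies near \<open>\<xi>0\<close>.\<close>
lemma closest_arg: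
  assumes \<omega>: "\<omega> = exp (- \<i> * of_real \<xi> + y)" and y: "norm y \<le> 1 / 2" and \<xi>0: "\<bar>\<xi>0 - \<xi>\<bar> \<le> 1 / 2"
    and arg: "is_Arg \<omega> (- \<xi>')"
    and closest: "\<And>x. is_Arg \<omega> (- x) \<Longrightarrow> \<bar>\<xi>' - \<xi>0\<bar> \<le> \<bar>x - \<xi>0\<bar>"
  shows "\<bar>\<xi>' - \<xi>\<bar> \<le> norm y"
proof -
  define x where "x = \<xi> - Im y"
  have "- \<i> * of_real \<xi> + y = of_real (Re y) + \<i> * of_real (- x)"
    by (simp add: x_def complex_eq_iff)
  then have "\<omega> = exp (of_real (Re y)) * exp (\<i> * of_real (- x))"
    unfolding \<omega> by (simp only: exp_add)
  moreover have "norm \<omega> = exp (Re y)" by (simp add: \<omega>)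
  ultimately have \<omega>x: "\<omega> = of_real (norm \<omega>) * exp (\<i> * of_real (- x))"
    by (simp only: exp_of_real)
  then have "is_Arg \<omega> (- x)" unfolding is_Arg_def .
  then have "\<bar>\<xi>' - \<xi>0\<bar> \<le> \<bar>x - \<xi>0\<bar>" by (rule closest)
  moreover have "\<bar>x - \<xi>\<bar> \<le> norm y" using abs_Im_le_cmod[of y] by (simp add: x_def)
  ultimately have near: "\<bar>\<xi>' - x\<bar> \<le> 2" using \<xi>0 y by linarith
  have "\<omega> \<noteq> 0" by (simp add: \<omega>)
  then have "exp (\<i> * of_real (- x)) = exp (\<i> * of_real (- \<xi>'))"
    using \<omega>x arg unfolding is_Arg_def by (metis mult_left_cancel norm_eq_zero of_real_eq_0_iff)
  then obtain n :: int where "\<i> * of_real (- x) = \<i> * of_real (- \<xi>') + of_real (of_int (2 * n) * pi) * \<i>"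
    unfolding exp_eq by blast
  then have "- x = - \<xi>' + 2 * of_int n * pi"
    by (auto simp: complex_eq_iff)
  then have "\<bar>of_int n\<bar> * pi \<le> 1" using near by (simp add: abs_mult)
  then have "n = 0"
  proof -
    have "\<bar>real_of_int n\<bar> * pi < 1 * pi" using \<open>\<bar>of_int n\<bar> * pi \<le> 1\<close> pi_gt3 by linarith
    then have "\<bar>real_of_int n\<bar> < 1" by (rule mult_right_less_imp_less) simp
    then show ?thesis by simp
  qed
  then have "\<xi>' = x" using \<open>- x = _\<close> by simp
  then show ?thesis using \<open>\<bar>x - \<xi>\<bar> \<le> norm y\<close> by simp
qed

section \<open>Interpolation at consecutive integers\<close>

definition lagrange_basis :: "nat \<Rightarrow> nat \<Rightarrow> complex poly" where
  "lagrange_basis d j = smult (inverse (\<Prod>i\<in>{1..d + 1} - {j}. of_nat j - of_nat i))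
     (\<Prod>i\<in>{1..d + 1} - {j}. [:- of_nat i, 1:])"

lemma degree_lagrange_basis_le:
  assumes "j \<in> {1..d + 1}"
  shows "degree (lagrange_basis d j) \<le> d"
proof -
  have "degree (\<Prod>i\<in>{1..d + 1} - {j}. [:- of_nat i, 1 :: complex:]) \<le> d"
    using degree_prod_sum_le[of "{1..d + 1} - {j}" "\<lambda>i. [:- of_nat i, 1 :: complex:]"] assms
    by simp
  then show ?thesis
    unfolding lagrange_basis_def by (rule order.trans[OF degree_smult_le])
qed

lemma poly_lagrange_basis:
  assumes "j \<in> {1..d + 1}" "k \<in> {1..d + 1}"
  shows "poly (lagrange_basis d j) (of_nat k) = (if j = k then 1 else 0)"
proof (cases "j = k")
  case True
  have "(\<Prod>i\<in>{1..d + 1} - {j}. of_nat j - of_nat i :: complex) \<noteq> 0" by simp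
  then show ?thesis using True by (simp add: lagrange_basis_def poly_prod)
next
  case False
  then have "(\<Prod>i\<in>{1..d + 1} - {j}. of_nat k - of_nat i :: complex) = 0"
    using assms by (intro prod_zero) auto
  then show ?thesis using False by (simp add: lagrange_basis_def poly_prod)
qed

text \<open>The inverse of the Vandermonde matrix at the nodes \<open>1, \<dots>, d + 1\<close> has the coefficients of the Lagrange
  basis as its entries. The equivalence provides both a solution of the linear system and, since the
  matrix depends on \<open>d\<close> only, the stability constant for its error.\<close>
lemma interpolation_system_iff:
  "(\<forall>j\<in>{1..d + 1}. e j = (\<Sum>l\<le>d. of_nat j ^ l * b l)) \<longleftrightarrow>
   (\<forall>l\<le>d. b l = (\<Sum>j\<in>{1..d + 1}. e j * coeff (lagrange_basis d j) l))"
proof -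
  define p where "p = (\<Sum>l\<le>d. monom (b l) l)"
  define q where "q = (\<Sum>j\<in>{1..d + 1}. smult (e j) (lagrange_basis d j))"
  have degp: "degree p \<le> d"
    unfolding p_def by (intro degree_sum_le) (auto intro: order.trans[OF degree_monom_le])
  have degq: "degree q \<le> d"
    unfolding q_def
    by (intro degree_sum_le) (auto intro!: order.trans[OF degree_smult_le] degree_lagrange_basis_le)
  have pj: "poly p (of_nat j) = (\<Sum>l\<le>d. of_nat j ^ l * b l)" for j
    by (simp add: p_def poly_sum poly_monom mult.commute)
  have qj: "poly q (of_nat j) = e j" if "j \<in> {1..d + 1}" for j
  proof -
    have "poly q (of_nat j) = (\<Sum>i\<in>{1..d + 1}. if i = j then e i else 0)"
      unfolding q_def poly_sum poly_smult using that
      by (intro sum.cong refl) (simp add: poly_lagrange_basis del: atLeastAtMost_iff)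
    then show ?thesis using that by simp
  qed
  have coeffs: "coeff p l = b l" if "l \<le> d" for l
    using that by (simp add: p_def coeff_sum)
  have "(\<forall>j\<in>{1..d + 1}. e j = (\<Sum>l\<le>d. of_nat j ^ l * b l)) \<longleftrightarrow>
      (\<forall>j\<in>{1..d + 1}. poly q (of_nat j) = poly p (of_nat j))"
    using pj qj by simp
  also have "\<dots> \<longleftrightarrow> p = q"
  proof
    assume *: "\<forall>j\<in>{1..d + 1}. poly q (of_nat j) = poly p (of_nat j)"
    have "card (of_nat ` {1..d + 1} :: complex set) = d + 1"
      by (subst card_image) (auto intro: inj_onI)
    then show "p = q"
      using * degp degq by (intro poly_eqI_degree[of "of_nat ` {1..d + 1}"]) auto
  qed simp
  also have "\<dots> \<longleftrightarrow> (\<forall>l\<le>d. coeff p l = coeff q l)"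
    using degp degq by (auto simp: poly_eq_iff) (metis coeff_eq_0 le_less_trans not_le)
  also have "\<dots> \<longleftrightarrow> (\<forall>l\<le>d. b l = (\<Sum>j\<in>{1..d + 1}. e j * coeff (lagrange_basis d j) l))"
    using coeffs by (simp add: q_def coeff_sum)
  finally show ?thesis .
qed

section \<open>The root of the decimated polynomial\<close>

lemma infdist_unit_sphere: "infdist u (sphere 0 1) = \<bar>norm u - 1\<bar>" for u :: complex
proof (rule antisym)
  have "\<exists>a. norm a = 1 \<and> u = of_real (norm u) * a"
  proof (cases "u = 0")
    case True
    then show ?thesis by (intro exI[of _ 1]) auto
  next
    case False
    then show ?thesis by (intro exI[of _ "u / of_real (norm u)"]) (auto simp: norm_divide)
  qed
  then obtain a where a: "norm a = 1" "u = of_real (norm u) * a" by blast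
  then have "u - a = of_real (norm u - 1) * a" by (metis left_diff_distrib mult_1 of_real_1 of_real_diff)
  then have "norm (u - a) = \<bar>norm u - 1\<bar>" using a(1) by (simp add: norm_mult del: of_real_diff)
  then show "infdist u (sphere 0 1) \<le> \<bar>norm u - 1\<bar>"
    using infdist_le[of a "sphere 0 1" u] a(1) by (simp add: dist_norm)
next
  obtain x where "x \<in> sphere 0 1" "infdist u (sphere 0 1) = dist u x"
    using infdist_attains_inf[of "sphere (0 :: complex) 1" u] by auto
  then show "\<bar>norm u - 1\<bar> \<le> infdist u (sphere 0 1)"
    using norm_triangle_ineq3[of u x] by (simp add: dist_norm)
qed

text \<open>For the true \<open>w\<close>, of norm \<open>1\<close>, the substitution \<open>u = w * v\<close> preserves the distance to the unit circle and
  places the root of the exact polynomial at \<open>1\<close>. Dividing by \<open>K\<close>, which will be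
  \<open>\<alpha> d * N ^ d\<close>, makes the normalized data converge as \<open>N\<close> grows.\<close>
lemma poly_decimated_poly_rotate:
  assumes w: "w \<noteq> 0" and K: "K \<noteq> 0"
    and m: "\<And>j. j \<le> d + 1 \<Longrightarrow> m ((j + 1) * N) = w ^ (j + 1) * p j + e j"
  shows "poly (decimated_poly d N m) (w * v) =
    w ^ (d + 2) * K * poly (alt_binom_poly (d + 1) (\<lambda>j. p j / K + e j / (w ^ (j + 1) * K))) v"
proof -
  have "poly (decimated_poly d N m) (w * v) =
      (\<Sum>j\<le>d + 1. (-1) ^ j * of_nat (d + 1 choose j) * m ((j + 1) * N) * (w * v) ^ (d + 1 - j))"
    by (simp add: decimated_poly_def poly_sum poly_monom)
  also have "\<dots> = (\<Sum>j\<le>d + 1. w ^ (d + 2) * K *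
      ((-1) ^ j * of_nat (d + 1 choose j) * (p j / K + e j / (w ^ (j + 1) * K)) * v ^ (d + 1 - j)))"
  proof (rule sum.cong[OF refl])
    fix j assume "j \<in> {..d + 1}"
    then have j: "j \<le> d + 1" by simp
    then have "d + 2 = (j + 1) + (d + 1 - j)" by simp
    then have wd: "w ^ (d + 2) = w ^ (j + 1) * w ^ (d + 1 - j)" by (metis power_add)
    have "m ((j + 1) * N) = w ^ (j + 1) * K * (p j / K + e j / (w ^ (j + 1) * K))"
      using m[OF j] w K by (simp add: field_simps)
    then show "(-1) ^ j * of_nat (d + 1 choose j) * m ((j + 1) * N) * (w * v) ^ (d + 1 - j) =
      w ^ (d + 2) * K *
      ((-1) ^ j * of_nat (d + 1 choose j) * (p j / K + e j / (w ^ (j + 1) * K)) * v ^ (d + 1 - j))"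
      unfolding wd power_mult_distrib by (simp only: mult_ac)
  qed
  also have "\<dots> = w ^ (d + 2) * K * poly (alt_binom_poly (d + 1) (\<lambda>j. p j / K + e j / (w ^ (j + 1) * K))) v"
    by (simp only: poly_alt_binom_poly sum_distrib_left)
  finally show ?thesis .
qed

text \<open>The leading term dominates: up to the ratio \<open>A / B\<close> of the coefficients, the terms with \<open>l < d\<close> are
  smaller by a factor of order at least \<open>N\<close>.\<close>
lemma jump_sum_normalized:
  fixes \<alpha> :: "nat \<Rightarrow> complex"
  assumes N: "N > 0" and B: "B > 0" and al: "\<And>l. l \<le> d \<Longrightarrow> norm (\<alpha> l) \<le> A"
    and ad: "B \<le> norm (\<alpha> d)" and k: "k \<le> d + 2"
  shows "norm ((\<Sum>l\<le>d. \<alpha> l * of_nat (k * N) ^ l) / (\<alpha> d * of_nat N ^ d) - of_nat k ^ d)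
     \<le> real (d + 1) * real (d + 2) ^ d * (A / (B * real N))"
proof -
  have A: "0 \<le> A" using al[of 0] norm_ge_zero order_trans by blast
  have ad0: "\<alpha> d \<noteq> 0" using ad B by auto
  have "(\<Sum>l\<le>d. \<alpha> l * of_nat (k * N) ^ l) = (\<Sum>l<d. \<alpha> l * of_nat (k * N) ^ l) + \<alpha> d * of_nat N ^ d * of_nat k ^ d"
    by (simp add: power_mult_distrib flip: lessThan_Suc_atMost)
  then have "(\<Sum>l\<le>d. \<alpha> l * of_nat (k * N) ^ l) / (\<alpha> d * of_nat N ^ d) - of_nat k ^ d =
      (\<Sum>l<d. \<alpha> l * of_nat (k * N) ^ l / (\<alpha> d * of_nat N ^ d))"
    using ad0 N by (simp add: add_divide_distrib sum_divide_distrib)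
  also have "norm \<dots> \<le> (\<Sum>l<d. real (d + 2) ^ d * (A / (B * real N)))"
  proof (rule sum_norm_le)
    fix l assume "l \<in> {..<d}"
    then have l: "l < d" by simp
    have "real N ^ Suc l \<le> real N ^ d" using l N by (intro power_increasing) auto
    have kl: "real k ^ l \<le> real (d + 2) ^ d"
    proof -
      have "real k ^ l \<le> real (d + 2) ^ l" using k by (intro power_mono) auto
      also have "\<dots> \<le> real (d + 2) ^ d" using l by (intro power_increasing) auto
      finally show ?thesis .
    qed
    have "norm (\<alpha> l * of_nat (k * N) ^ l / (\<alpha> d * of_nat N ^ d)) =
        norm (\<alpha> l) * (real k ^ l) * (real N ^ l / real N ^ d) / norm (\<alpha> d)"
      by (simp add: norm_mult norm_divide norm_power power_mult_distrib mult_ac)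
    also have "\<dots> \<le> A * real (d + 2) ^ d * (1 / real N) / B"
    proof (rule frac_le)
      have "real N ^ l / real N ^ d \<le> 1 / real N"
        using N \<open>real N ^ Suc l \<le> real N ^ d\<close> by (simp add: field_simps)
      then show "norm (\<alpha> l) * real k ^ l * (real N ^ l / real N ^ d) \<le> A * real (d + 2) ^ d * (1 / real N)"
        using al[of l] l kl A by (intro mult_mono) auto
    qed (use A B ad in auto)
    finally show "norm (\<alpha> l * of_nat (k * N) ^ l / (\<alpha> d * of_nat N ^ d)) \<le> real (d + 2) ^ d * (A / (B * real N))"
      by (simp add: mult_ac)
  qed
  also have "\<dots> \<le> real (d + 1) * real (d + 2) ^ d * (A / (B * real N))"
    using A B by (simp add: mult_right_mono divide_right_mono)
  finally show ?thesis .
qed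

text \<open>That \<open>N\<close> is large is expressed only through \<open>A / (B * N)\<close>, which measures how far the exact data are from
  their limit, and \<open>R / (B * N)\<close>, which dominates the normalized noise. So one threshold for \<open>N\<close>
  serves all parameters within the bounds \<open>A\<close>, \<open>B\<close>, \<open>R\<close>.\<close>
lemma decimated_root_estimate:
  obtains \<epsilon> C :: real where "0 < \<epsilon>" "0 < C"
    "\<And>A B R N w \<alpha> \<delta> m.
      \<lbrakk>A > 0; B > 0; R > 0; N > 0; A / (B * real N) \<le> \<epsilon>; R / (B * real N) \<le> \<epsilon>;
       norm w = 1; \<And>l. l \<le> d \<Longrightarrow> norm (\<alpha> l) \<le> A; B \<le> norm (\<alpha> d);
       \<And>j. j \<in> {1..d + 2} \<Longrightarrow>
          m (j * N) = w ^ j * (\<Sum>l\<le>d. \<alpha> l * of_nat (j * N) ^ l) + \<delta> (j * N);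
       \<And>j. j \<in> {1..d + 2} \<Longrightarrow> norm (\<delta> (j * N)) \<le> R / real (j * N)\<rbrakk> \<Longrightarrow>
      decimated_poly d N m \<noteq> 0 \<and> (\<exists>u. poly (decimated_poly d N m) u = 0) \<and>
      (\<forall>z. is_arg_min (\<lambda>u. infdist u (sphere 0 1)) (\<lambda>u. poly (decimated_poly d N m) u = 0) z \<longrightarrow>
         norm (z / w - 1) \<le> C * (R / (B * real N ^ (d + 1))))"
proof -
  obtain \<epsilon> C :: real where \<epsilon>: "0 < \<epsilon>" and C: "0 < C" and
    main: "\<And>x y \<tau>. \<lbrakk>\<And>j. j \<le> d + 1 \<Longrightarrow> norm (x j - of_nat (j + 1) ^ d) \<le> \<epsilon>;
        (\<Sum>j\<le>d + 1. (-1) ^ j * of_nat (d + 1 choose j) * x j) = 0;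
        \<And>j. j \<le> d + 1 \<Longrightarrow> norm (y j) \<le> \<tau>; \<tau> \<le> \<epsilon>\<rbrakk> \<Longrightarrow>
      alt_binom_poly (d + 1) (\<lambda>j. x j + y j) \<noteq> 0 \<and>
      (\<exists>v. poly (alt_binom_poly (d + 1) (\<lambda>j. x j + y j)) v = 0) \<and>
      (\<forall>z. poly (alt_binom_poly (d + 1) (\<lambda>j. x j + y j)) z = 0 \<longrightarrow>
         (\<forall>v. poly (alt_binom_poly (d + 1) (\<lambda>j. x j + y j)) v = 0 \<longrightarrow>
              \<bar>norm z - 1\<bar> \<le> \<bar>norm v - 1\<bar>) \<longrightarrow>
         norm (z - 1) \<le> C * \<tau>)"
    by (fact alt_binom_poly_closest_root[of d])
  define K where "K = real (d + 1) * real (d + 2) ^ d"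
  have K: "1 \<le> K" unfolding K_def using one_le_power[of "real (d + 2)" d]
      mult_mono[of 1 "real (d + 1)" 1 "real (d + 2) ^ d"] by simp
  show ?thesis
  proof (rule that[of "\<epsilon> / K" C])
    fix A B R :: real and N :: nat and w :: complex and \<alpha> \<delta> m :: "nat \<Rightarrow> complex"
    assume pos: "A > 0" "B > 0" "R > 0" "N > 0"
      and AN: "A / (B * real N) \<le> \<epsilon> / K" and RN: "R / (B * real N) \<le> \<epsilon> / K"
      and w: "norm w = 1" and al: "\<And>l. l \<le> d \<Longrightarrow> norm (\<alpha> l) \<le> A" and ad: "B \<le> norm (\<alpha> d)"
      and m: "\<And>j. j \<in> {1..d + 2} \<Longrightarrow>
          m (j * N) = w ^ j * (\<Sum>l\<le>d. \<alpha> l * of_nat (j * N) ^ l) + \<delta> (j * N)"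
      and \<delta>: "\<And>j. j \<in> {1..d + 2} \<Longrightarrow> norm (\<delta> (j * N)) \<le> R / real (j * N)"
    define L where "L = \<alpha> d * of_nat N ^ d"
    define p where "p = (\<lambda>j. \<Sum>l\<le>d. \<alpha> l * of_nat ((j + 1) * N) ^ l)"
    define x where "x = (\<lambda>j. p j / L)"
    define y where "y = (\<lambda>j. \<delta> ((j + 1) * N) / (w ^ (j + 1) * L))"
    define \<tau> where "\<tau> = R / (B * real N ^ (d + 1))"
    define Q where "Q = alt_binom_poly (d + 1) (\<lambda>j. x j + y j)"
    have w0: "w \<noteq> 0" using w by auto
    have L0: "L \<noteq> 0" using ad pos by (auto simp: L_def)
    have rot: "poly (decimated_poly d N m) (w * v) = w ^ (d + 2) * L * poly Q v" for v
      unfolding Q_def x_def y_def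
    proof (rule poly_decimated_poly_rotate[OF w0 L0])
      fix j assume "j \<le> d + 1"
      then show "m ((j + 1) * N) = w ^ (j + 1) * p j + \<delta> ((j + 1) * N)"
        unfolding p_def by (intro m) simp
    qed
    have rot': "poly (decimated_poly d N m) u = w ^ (d + 2) * L * poly Q (u / w)" for u
      using rot[of "u / w"] w0 by simp
    have "norm (x j - of_nat (j + 1) ^ d) \<le> \<epsilon>" if "j \<le> d + 1" for j
    proof -
      have "norm (x j - of_nat (j + 1) ^ d) \<le> K * (A / (B * real N))"
        unfolding x_def p_def L_def K_def
        using pos al ad that by (intro jump_sum_normalized) auto
      also have "\<dots> \<le> K * (\<epsilon> / K)" using AN K by (intro mult_left_mono) auto
      finally show ?thesis using K by simp
    qed
    moreover have "(\<Sum>j\<le>d + 1. (-1) ^ j * of_nat (d + 1 choose j) * x j) = 0"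
    proof -
      have "(\<Sum>j\<le>d + 1. (-1) ^ j * of_nat (d + 1 choose j) * x j) =
          (\<Sum>j\<le>d + 1. \<Sum>l\<le>d. (\<alpha> l * of_nat N ^ l / L) *
             ((-1) ^ j * of_nat (d + 1 choose j) * of_nat (j + 1) ^ l))"
        unfolding x_def p_def of_nat_mult power_mult_distrib sum_divide_distrib sum_distrib_left
        by (intro sum.cong refl) (simp add: field_simps)
      also have "\<dots> = (\<Sum>l\<le>d. (\<alpha> l * of_nat N ^ l / L) *
             (\<Sum>j\<le>d + 1. (-1) ^ j * of_nat (d + 1 choose j) * of_nat (j + 1) ^ l))"
        by (subst sum.swap) (simp only: sum_distrib_left)
      also have "\<dots> = 0"
      proof (rule sum.neutral, rule ballI)
        fix l assume "l \<in> {..d}"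
        then have "l < d + 1" by simp
        from alt_binom_sum_power_eq_0[OF this]
        show "(\<alpha> l * of_nat N ^ l / L) *
             (\<Sum>j\<le>d + 1. (-1) ^ j * of_nat (d + 1 choose j) * of_nat (j + 1) ^ l) = 0"
          by (simp only: mult_zero_right)
      qed
      finally show ?thesis .
    qed
    moreover have "norm (y j) \<le> \<tau>" if j: "j \<le> d + 1" for j
    proof -
      have "norm (\<delta> ((j + 1) * N)) \<le> R / real ((j + 1) * N)" using j by (intro \<delta>) simp
      also have "\<dots> \<le> R / real N" using pos by (intro frac_le) auto
      finally have "norm (\<delta> ((j + 1) * N)) / norm L \<le> (R / real N) / norm L"
        by (intro divide_right_mono) auto
      moreover have "norm (y j) = norm (\<delta> ((j + 1) * N)) / norm L"
        using w by (simp add: y_def norm_divide norm_mult norm_power)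
      ultimately have "norm (y j) \<le> (R / real N) / norm L" by simp
      also have "\<dots> \<le> (R / real N) / (B * real N ^ d)"
        using ad pos by (intro frac_le) (auto simp: L_def norm_mult norm_power mult_right_mono)
      also have "\<dots> = \<tau>" by (simp add: \<tau>_def)
      finally show ?thesis .
    qed
    moreover have "\<tau> \<le> \<epsilon>"
    proof -
      have "real N ^ 1 \<le> real N ^ (d + 1)" using pos by (intro power_increasing) auto
      then have "\<tau> \<le> R / (B * real N)"
        unfolding \<tau>_def using pos by (intro divide_left_mono mult_left_mono) auto
      also have "\<dots> \<le> \<epsilon> / 1" using K \<epsilon> by (intro order.trans[OF RN] divide_left_mono) auto
      finally show ?thesis by simp
    qed
    ultimately have Q: "Q \<noteq> 0" "\<exists>v. poly Q v = 0"
      "\<And>z. poly Q z = 0 \<Longrightarrow> (\<And>v. poly Q v = 0 \<Longrightarrow> \<bar>norm z - 1\<bar> \<le> \<bar>norm v - 1\<bar>) \<Longrightarrow>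
         norm (z - 1) \<le> C * \<tau>"
      using main[of x y \<tau>] unfolding Q_def by blast+
    have "decimated_poly d N m \<noteq> 0"
    proof
      assume "decimated_poly d N m = 0"
      then have "\<And>v. poly Q v = 0" using rot w0 L0 by simp
      then show False using Q(1) poly_all_0_iff_0 by blast
    qed
    moreover have "\<exists>u. poly (decimated_poly d N m) u = 0"
    proof -
      obtain v where "poly Q v = 0" using Q(2) by blast
      then have "poly (decimated_poly d N m) (w * v) = 0" using rot by simp
      then show ?thesis by blast
    qed
    moreover have "norm (z / w - 1) \<le> C * \<tau>"
      if z: "is_arg_min (\<lambda>u. infdist u (sphere 0 1)) (\<lambda>u. poly (decimated_poly d N m) u = 0) z" for z
    proof (rule Q(3))
      show "poly Q (z / w) = 0" using z rot'[of z] w0 L0 by (simp add: is_arg_min_def)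
      fix v assume "poly Q v = 0"
      then have "poly (decimated_poly d N m) (w * v) = 0" using rot by simp
      then have "\<bar>norm z - 1\<bar> \<le> \<bar>norm (w * v) - 1\<bar>"
        using z unfolding is_arg_min_def infdist_unit_sphere by (auto simp: not_less)
      then show "\<bar>norm (z / w) - 1\<bar> \<le> \<bar>norm v - 1\<bar>"
        using w by (simp add: norm_mult norm_divide)
    qed
    ultimately show "decimated_poly d N m \<noteq> 0 \<and> (\<exists>u. poly (decimated_poly d N m) u = 0) \<and>
      (\<forall>z. is_arg_min (\<lambda>u. infdist u (sphere 0 1)) (\<lambda>u. poly (decimated_poly d N m) u = 0) z \<longrightarrow>
         norm (z / w - 1) \<le> C * (R / (B * real N ^ (d + 1))))"
      unfolding \<tau>_def by blast
  qed (use \<epsilon> C K in auto)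
qed

section \<open>Errors of the jump location and the amplitudes\<close>

text \<open>The residual of the true amplitudes in the \<open>j\<close>-th equation. It has a part from the wrong frequency,
  a relative error of order \<open>R / (B * N ^ (d + 1))\<close> in a moment of size up to \<open>A * N ^ d\<close>, and a part
  from the noise, of order \<open>R / N\<close>; their sum has order \<open>R * (1 + A / B) / N\<close>.\<close>
lemma amplitude_system_error:
  fixes \<alpha> \<alpha>' m \<delta> :: "nat \<Rightarrow> complex" and w z :: complex
  assumes pos: "A > 0" "B > 0" "R > 0" "N > 0" "C > 0" and w: "norm w = 1"
    and al: "\<And>l. l \<le> d \<Longrightarrow> norm (\<alpha> l) \<le> A"
    and m: "m (j * N) = w ^ j * (\<Sum>l\<le>d. \<alpha> l * of_nat (j * N) ^ l) + \<delta> (j * N)"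
    and \<delta>: "norm (\<delta> (j * N)) \<le> R / real (j * N)"
    and j: "j \<in> {1..d + 1}"
    and z: "norm (z / w - 1) \<le> C * (R / (B * real N ^ (d + 1)))" "norm (z / w - 1) \<le> 1 / 2"
    and sys: "m (j * N) / z ^ j = (\<Sum>l\<le>d. of_nat (j * N) ^ l * \<alpha>' l)"
  shows "norm (\<Sum>l\<le>d. of_nat j ^ l * (of_nat N ^ l * (\<alpha>' l - \<alpha> l)))
    \<le> (real (d + 1) ^ (d + 2) * 2 ^ (d + 2) * C + 2 ^ (d + 1)) * (R * (1 + A / B) / real N)"
proof -
  define P where "P = (\<Sum>l\<le>d. \<alpha> l * of_nat (j * N) ^ l)"
  define s where "s = w / z"
  define \<kappa> where "\<kappa> = norm (z / w - 1)"
  have w0: "w \<noteq> 0" using w by auto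
  have nz: "1 / 2 \<le> norm z"
    using z(2) w norm_triangle_ineq2[of 1 "z / w"] by (simp add: norm_divide norm_minus_commute)
  then have z0: "z \<noteq> 0" by auto
  have ns: "norm s \<le> 2" using nz w z0 by (simp add: s_def norm_divide field_simps)
  \<comment> \<open>\<open>s\<close> is the inverse of \<open>z / w\<close>; the error enters the system through its powers.\<close>
  have "s - 1 = - (s * (z / w - 1))" using z0 w0 by (simp add: s_def field_simps)
  then have "norm (s - 1) = norm s * \<kappa>" by (simp only: norm_minus_cancel norm_mult \<kappa>_def)
  then have s1: "norm (s - 1) \<le> 2 * \<kappa>" using ns by (simp add: \<kappa>_def mult_right_mono)
  have jd: "1 \<le> j" "j \<le> d + 1" using j by auto
  have twoj: "(2 :: real) ^ j \<le> 2 ^ (d + 1)" using jd by (intro power_increasing) auto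
  have "(\<Sum>l\<le>d. of_nat j ^ l * (of_nat N ^ l * (\<alpha>' l - \<alpha> l))) = (\<Sum>l\<le>d. of_nat (j * N) ^ l * \<alpha>' l) - P"
    unfolding P_def sum_subtractf[symmetric]
    by (intro sum.cong refl) (simp add: power_mult_distrib algebra_simps)
  also have "\<dots> = P * (s ^ j - 1) + \<delta> (j * N) / z ^ j"
    unfolding sys[symmetric] m P_def[symmetric] s_def using z0
    by (simp add: power_divide field_simps)
  finally have eq: "(\<Sum>l\<le>d. of_nat j ^ l * (of_nat N ^ l * (\<alpha>' l - \<alpha> l))) = P * (s ^ j - 1) + \<delta> (j * N) / z ^ j" .
  have P: "norm P \<le> real (d + 1) * (A * (real (d + 1) * real N) ^ d)"
  proof -
    have "norm P \<le> (\<Sum>l\<le>d. A * (real (d + 1) * real N) ^ d)"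
      unfolding P_def
    proof (rule sum_norm_le)
      fix l assume "l \<in> {..d}"
      then have l: "l \<le> d" by simp
      have "real (j * N) ^ l \<le> (real (d + 1) * real N) ^ l"
        unfolding of_nat_mult using jd by (intro power_mono mult_right_mono) auto
      also have "1 * 1 \<le> real (d + 1) * real N" using pos by (intro mult_mono) auto
      then have "(real (d + 1) * real N) ^ l \<le> (real (d + 1) * real N) ^ d"
        using l by (intro power_increasing) auto
      finally have "real (j * N) ^ l \<le> (real (d + 1) * real N) ^ d" .
      then have "norm (\<alpha> l) * real (j * N) ^ l \<le> A * (real (d + 1) * real N) ^ d"
        using al[OF l] pos by (intro mult_mono) auto
      then show "norm (\<alpha> l * of_nat (j * N) ^ l) \<le> A * (real (d + 1) * real N) ^ d"
        by (simp only: norm_mult norm_power norm_of_nat)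
    qed
    then show ?thesis by simp
  qed
  have "norm (s ^ j - 1) \<le> real j * 2 ^ j * norm (s - 1)"
    by (rule norm_power_diff_1_le[OF ns])
  also have "\<dots> \<le> real (d + 1) * 2 ^ (d + 1) * (2 * (C * (R / (B * real N ^ (d + 1)))))"
    using s1 z(1) twoj jd unfolding \<kappa>_def by (intro mult_mono) auto
  finally have sj: "norm (s ^ j - 1) \<le> \<dots>" .
  have "norm (P * (s ^ j - 1)) \<le> (real (d + 1) * (A * (real (d + 1) * real N) ^ d)) *
      (real (d + 1) * 2 ^ (d + 1) * (2 * (C * (R / (B * real N ^ (d + 1))))))"
    unfolding norm_mult using P sj pos by (intro mult_mono) auto
  also have "\<dots> = (real (d + 1) ^ (d + 2) * 2 ^ (d + 2) * C) * (R * (A / B) / real N)"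
  proof -
    have "(D * (A * (D * n) ^ d)) * (D * 2 ^ (d + 1) * (2 * (C * (R / (B * n ^ (d + 1)))))) =
        (D ^ (d + 2) * 2 ^ (d + 2) * C) * (R * (A / B) / n)" if "n > 0" for D n :: real
      using pos(2) that by (simp add: field_simps power_mult_distrib)
    then show ?thesis using pos(4) by simp
  qed
  also have "\<dots> \<le> (real (d + 1) ^ (d + 2) * 2 ^ (d + 2) * C) * (R * (1 + A / B) / real N)"
    using pos by (intro mult_left_mono divide_right_mono) auto
  finally have t1: "norm (P * (s ^ j - 1)) \<le> \<dots>" .
  have "norm (\<delta> (j * N) / z ^ j) \<le> (R / real N) * 2 ^ (d + 1)"
  proof -
    have "norm (\<delta> (j * N)) \<le> R / real N"
      using \<delta> jd pos by (elim order.trans) (intro frac_le, auto)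
    moreover have "norm (inverse (z ^ j)) \<le> 2 ^ (d + 1)"
    proof -
      have "norm (inverse (z ^ j)) = (inverse (norm z)) ^ j"
        by (simp add: norm_inverse norm_power power_inverse)
      also have "\<dots> \<le> 2 ^ j" using nz z0 by (intro power_mono) (auto simp: field_simps)
      finally show ?thesis using twoj by linarith
    qed
    ultimately show ?thesis
      unfolding divide_inverse[of "\<delta> (j * N)"] norm_mult using pos by (intro mult_mono) auto
  qed
  also have "\<dots> \<le> 2 ^ (d + 1) * (R * (1 + A / B) / real N)"
    using pos by (simp add: field_simps)
  finally have t2: "norm (\<delta> (j * N) / z ^ j) \<le> \<dots>" .
  show ?thesis
    unfolding eq distrib_right using t1 t2 by (intro order.trans[OF norm_triangle_ineq]) (rule add_mono)
qed

lemma ex_arg_min_dist: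
  fixes a :: "'a :: heine_borel"
  assumes "closed {x. P x}" "P x"
  shows "\<exists>x. is_arg_min (\<lambda>x. dist x a) P x"
proof -
  obtain y where "y \<in> {x. P x}" "\<And>x. x \<in> {x. P x} \<Longrightarrow> dist a y \<le> dist a x"
    using assms by (elim distance_attains_inf[of "{x. P x}" a]) auto
  then show ?thesis unfolding is_arg_min_def by (auto simp: dist_commute not_less)
qed

lemma decimated_output_exists:
  assumes "N > 0" "decimated_poly d N m \<noteq> 0" "poly (decimated_poly d N m) u = 0"
  shows "\<exists>\<xi>' \<alpha>'. decimated_output d N m \<xi>0 \<xi>' \<alpha>'"
proof -
  obtain z where z: "is_arg_min (\<lambda>u. infdist u (sphere 0 1)) (\<lambda>u. poly (decimated_poly d N m) u = 0) z"
    using ex_is_arg_min_if_finite[of "{u. poly (decimated_poly d N m) u = 0}" "\<lambda>u. infdist u (sphere 0 1)"]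
      poly_roots_finite[OF assms(2)] assms(3) by auto
  have "\<exists>w. w ^ N = z"
  proof (cases "z = 0")
    case True
    then show ?thesis using assms(1) by (intro exI[of _ 0]) simp
  next
    case False
    then have "exp (Ln z / of_nat N) ^ N = z"
      using assms(1) by (simp flip: exp_of_nat_mult)
    then show ?thesis by blast
  qed
  moreover have "closed {w. w ^ N = z}"
    by (intro closed_Collect_eq continuous_intros)
  ultimately obtain \<omega> where \<omega>: "is_arg_min (\<lambda>w. dist w (exp (- \<i> * of_real \<xi>0))) (\<lambda>w. w ^ N = z) \<omega>"
    using ex_arg_min_dist by blast
  have "closed {x. is_Arg \<omega> (- x)}"
    unfolding is_Arg_def by (intro closed_Collect_eq continuous_intros)
  moreover have "is_Arg \<omega> (- (- Arg \<omega>))"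
    by (cases "\<omega> = 0") (auto simp: is_Arg_def Arg_eq)
  ultimately obtain \<xi>' where \<xi>': "is_arg_min (\<lambda>x. dist x \<xi>0) (\<lambda>x. is_Arg \<omega> (- x)) \<xi>'"
    using ex_arg_min_dist[where P = "\<lambda>x. is_Arg \<omega> (- x)"] by blast
  define e where "e = (\<lambda>j. m (j * N) * \<omega> powi (- int (j * N)))"
  define b where "b = (\<lambda>l. \<Sum>j\<in>{1..d + 1}. e j * coeff (lagrange_basis d j) l)"
  define \<alpha>' where "\<alpha>' = (\<lambda>l. b l / of_nat N ^ l)"
  have "\<forall>j\<in>{1..d + 1}. e j = (\<Sum>l\<le>d. of_nat j ^ l * b l)"
    unfolding interpolation_system_iff by (simp add: b_def)
  then have "\<forall>j\<in>{1..d + 1}. e j = (\<Sum>l\<le>d. of_nat (j * N) ^ l * \<alpha>' l)"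
    using assms(1) by (simp add: \<alpha>'_def power_mult_distrib)
  then show ?thesis
    unfolding decimated_output_def using z \<omega> \<xi>' e_def by (auto simp: dist_real_def)
qed

text \<open>Scaling the unknowns by \<open>N ^ l\<close> turns the amplitude system into interpolation at \<open>1, \<dots>, d + 1\<close>, so that
  all scaled errors have order \<open>R * (1 + A / B) / N\<close> and unscaling gives the factor \<open>N ^ (l + 1)\<close>.\<close>
lemma decimated_output_error:
  assumes pos: "A > 0" "B > 0" "R > 0" "N > 0" "C > 0"
    and a: "\<And>l. l \<le> d \<Longrightarrow> norm (a l) \<le> A"
    and m: "\<And>j. j \<in> {1..d + 2} \<Longrightarrow> m (j * N) = jump_moment d \<xi> a (j * N) + \<delta> (j * N)"
    and \<delta>: "\<And>j. j \<in> {1..d + 2} \<Longrightarrow> norm (\<delta> (j * N)) \<le> R / real (j * N)"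
    and \<xi>0: "\<bar>\<xi>0 - \<xi>\<bar> \<le> 1 / (8 * real N)"
    and small: "C * (R / (B * real N ^ (d + 1))) \<le> 1 / 32"
    and root: "\<And>z. is_arg_min (\<lambda>u. infdist u (sphere 0 1)) (\<lambda>u. poly (decimated_poly d N m) u = 0) z \<Longrightarrow>
       norm (z / exp (- \<i> * of_real \<xi>) ^ N - 1) \<le> C * (R / (B * real N ^ (d + 1)))"
    and out: "decimated_output d N m \<xi>0 \<xi>' \<alpha>'"
  shows "\<bar>\<xi>' - \<xi>\<bar> \<le> 2 * C * (R / B) / real N ^ (d + 2)"
    and "l \<le> d \<Longrightarrow> norm (\<alpha>' l - jump_alpha d a l) \<le>
      (real (d + 1) ^ (d + 2) * 2 ^ (d + 2) * C + 2 ^ (d + 1)) *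
      (\<Sum>j\<in>{1..d + 1}. norm (coeff (lagrange_basis d j) l)) * R * (1 + A / B) / real N ^ (l + 1)"
proof -
  define w where "w = exp (- \<i> * of_real \<xi>) ^ N"
  define \<kappa> where "\<kappa> = C * (R / (B * real N ^ (d + 1)))"
  obtain z \<omega> where
    z: "is_arg_min (\<lambda>u. infdist u (sphere 0 1)) (\<lambda>u. poly (decimated_poly d N m) u = 0) z" and
    \<omega>: "is_arg_min (\<lambda>w. dist w (exp (- \<i> * of_real \<xi>0))) (\<lambda>w. w ^ N = z) \<omega>" and
    \<xi>': "is_arg_min (\<lambda>x. \<bar>x - \<xi>0\<bar>) (\<lambda>x. is_Arg \<omega> (- x)) \<xi>'" and
    sys: "\<And>j. j \<in> {1..d + 1} \<Longrightarrow>
      m (j * N) * \<omega> powi (- int (j * N)) = (\<Sum>l\<le>d. of_nat (j * N) ^ l * \<alpha>' l)"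
    using out unfolding decimated_output_def by blast
  have e1: "norm (exp (- \<i> * of_real \<xi>)) = 1" using norm_exp_i_times[of "- \<xi>"] by simp
  then have nw: "norm w = 1" by (simp only: w_def norm_power power_one)
  then have w0: "w \<noteq> 0" by auto
  have zw: "norm (z / w - 1) \<le> \<kappa>" unfolding w_def \<kappa>_def using z by (rule root)
  have zw32: "norm (z / w - 1) \<le> 1 / 32" using zw small unfolding \<kappa>_def by linarith
  have \<omega>N: "\<omega> ^ N = z" using \<omega> by (simp add: is_arg_min_def)
  have zeq: "exp (- \<i> * of_real \<xi>) ^ N * (z / w) = z" using w0 by (simp add: w_def)
  obtain y where y: "\<omega> = exp (- \<i> * of_real \<xi> + y)" "norm y \<le> 2 * norm (z / w - 1) / real N"
  proof (rule closest_nth_root[of N \<omega> \<xi> "z / w" \<xi>0])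
    fix v assume "v ^ N = exp (- \<i> * of_real \<xi>) ^ N * (z / w)"
    then show "dist \<omega> (exp (- \<i> * of_real \<xi>0)) \<le> dist v (exp (- \<i> * of_real \<xi>0))"
      using \<omega> unfolding zeq is_arg_min_def by (auto simp: not_less)
  qed (use pos \<omega>N zw32 \<xi>0 zeq in auto)
  have N1: "1 \<le> real N" using pos by simp
  have "norm y \<le> 2 * \<kappa> / real N"
    using zw N1 by (intro order.trans[OF y(2)] divide_right_mono) auto
  also have "\<dots> = 2 * C * (R / B) / real N ^ (d + 2)" by (simp add: \<kappa>_def field_simps)
  finally have y': "norm y \<le> 2 * C * (R / B) / real N ^ (d + 2)" .
  have "2 * norm (z / w - 1) / real N \<le> 2 * (1 / 32) / 1"
    using zw32 N1 by (intro frac_le) auto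
  then have "norm y \<le> 1 / 2" using y(2) by linarith
  moreover have "1 / (8 * real N) \<le> 1 / 2" using N1 by (simp add: field_simps)
  ultimately have "\<bar>\<xi>' - \<xi>\<bar> \<le> norm y"
    using \<xi>0 \<xi>' by (intro closest_arg[OF y(1), of \<xi>0]) (auto simp: is_arg_min_def not_less)
  then show "\<bar>\<xi>' - \<xi>\<bar> \<le> 2 * C * (R / B) / real N ^ (d + 2)" using y' by linarith

  assume l: "l \<le> d"
  define K where "K = (real (d + 1) ^ (d + 2) * 2 ^ (d + 2) * C + 2 ^ (d + 1)) * (R * (1 + A / B) / real N)"
  define b where "b = (\<lambda>l. of_nat N ^ l * (\<alpha>' l - jump_alpha d a l))"
  define e where "e = (\<lambda>j. \<Sum>l\<le>d. of_nat j ^ l * b l)"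
  have e: "norm (e j) \<le> K" if j: "j \<in> {1..d + 1}" for j
    unfolding e_def b_def K_def
  proof (rule amplitude_system_error[OF pos nw])
    show "m (j * N) = w ^ j * (\<Sum>l\<le>d. jump_alpha d a l * of_nat (j * N) ^ l) + \<delta> (j * N)"
    proof -
      have "w ^ j = exp (- \<i> * of_real \<xi>) ^ (j * N)"
        unfolding w_def by (simp only: mult.commute[of j N] power_mult)
      then show ?thesis using m[of j] j by (simp add: jump_moment_def)
    qed
    show "norm (\<delta> (j * N)) \<le> R / real (j * N)" using j by (intro \<delta>) simp
    show "norm (z / w - 1) \<le> C * (R / (B * real N ^ (d + 1)))" using zw by (simp add: \<kappa>_def)
    show "norm (z / w - 1) \<le> 1 / 2" using zw32 by simp
    show "m (j * N) / z ^ j = (\<Sum>l\<le>d. of_nat (j * N) ^ l * \<alpha>' l)"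
    proof -
      have "\<omega> powi (- int (j * N)) = inverse (z ^ j)"
        unfolding power_int_minus power_int_of_nat using \<omega>N by (metis mult.commute power_mult)
      then show ?thesis using sys[OF j] by (simp only: divide_inverse)
    qed
  qed (use a j in \<open>auto simp: jump_alpha_def norm_mult norm_power\<close>)
  have "\<forall>j\<in>{1..d + 1}. e j = (\<Sum>l\<le>d. of_nat j ^ l * b l)" by (simp add: e_def)
  then have "b l = (\<Sum>j\<in>{1..d + 1}. e j * coeff (lagrange_basis d j) l)"
    unfolding interpolation_system_iff using l by blast
  also have "norm \<dots> \<le> (\<Sum>j\<in>{1..d + 1}. K * norm (coeff (lagrange_basis d j) l))"
    using e by (intro sum_norm_le) (auto simp: norm_mult intro!: mult_right_mono)
  also have "\<dots> = K * (\<Sum>j\<in>{1..d + 1}. norm (coeff (lagrange_basis d j) l))"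
    by (rule sum_distrib_left[symmetric])
  finally have "real N ^ l * norm (\<alpha>' l - jump_alpha d a l) \<le> K * (\<Sum>j\<in>{1..d + 1}. norm (coeff (lagrange_basis d j) l))"
    by (simp add: b_def norm_mult norm_power)
  then have "norm (\<alpha>' l - jump_alpha d a l) \<le> K * (\<Sum>j\<in>{1..d + 1}. norm (coeff (lagrange_basis d j) l)) / real N ^ l"
    using pos by (simp add: pos_le_divide_eq mult.commute)
  also have "\<dots> = (real (d + 1) ^ (d + 2) * 2 ^ (d + 2) * C + 2 ^ (d + 1)) *
      (\<Sum>j\<in>{1..d + 1}. norm (coeff (lagrange_basis d j) l)) * R * (1 + A / B) / real N ^ (l + 1)"
    by (simp add: K_def)
  finally show "norm (\<alpha>' l - jump_alpha d a l) \<le>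
      (real (d + 1) ^ (d + 2) * 2 ^ (d + 2) * C + 2 ^ (d + 1)) *
      (\<Sum>j\<in>{1..d + 1}. norm (coeff (lagrange_basis d j) l)) * R * (1 + A / B) / real N ^ (l + 1)" .
qed

theorem theorem12:
  fixes d :: nat
  shows "\<exists>(C4 :: real) (C5 :: nat \<Rightarrow> real).
    \<forall>(A :: real) (B :: real) (R :: real) (\<rho> :: nat \<Rightarrow> real).
      A > 0 \<and> B > 0 \<and> R > 0 \<and> \<rho> \<longlonglongrightarrow> 0 \<longrightarrow>
      (\<exists>N0. \<forall>N\<ge>N0. \<forall>(\<xi> :: real) (a :: nat \<Rightarrow> complex) (\<delta> :: nat \<Rightarrow> complex)
          (m :: nat \<Rightarrow> complex) (\<xi>0 :: real).
        \<xi> \<in> {- pi..pi} \<and>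
        (\<forall>l\<le>d. norm (a l) \<le> A) \<and> norm (a 0) \<ge> B \<and>
        (\<forall>j\<in>{1..d + 2}. m (j * N) = jump_moment d \<xi> a (j * N) + \<delta> (j * N)) \<and>
        (\<forall>j\<in>{1..d + 2}. norm (\<delta> (j * N)) \<le> R / real (j * N)) \<and>
        \<bar>\<xi>0 - \<xi>\<bar> \<le> \<rho> N / real N \<longrightarrow>
        (\<exists>\<xi>' \<alpha>'. decimated_output d N m \<xi>0 \<xi>' \<alpha>') \<and>
        (\<forall>\<xi>' \<alpha>'. decimated_output d N m \<xi>0 \<xi>' \<alpha>' \<longrightarrow>
           \<bar>\<xi>' - \<xi>\<bar> \<le> C4 * (R / B) / real N ^ (d + 2) \<and>
           (\<forall>l\<le>d. norm (\<alpha>' l - jump_alpha d a l)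
                    \<le> C5 l * R * (1 + A / B) / real N ^ (l + 1))))"
proof -
  obtain \<epsilon> C :: real where \<epsilon>: "0 < \<epsilon>" and C: "0 < C" and
    root: "\<And>A B R N w \<alpha> \<delta> m.
      \<lbrakk>A > 0; B > 0; R > 0; N > 0; A / (B * real N) \<le> \<epsilon>; R / (B * real N) \<le> \<epsilon>;
       norm w = 1; \<And>l. l \<le> d \<Longrightarrow> norm (\<alpha> l) \<le> A; B \<le> norm (\<alpha> d);
       \<And>j. j \<in> {1..d + 2} \<Longrightarrow>
          m (j * N) = w ^ j * (\<Sum>l\<le>d. \<alpha> l * of_nat (j * N) ^ l) + \<delta> (j * N);
       \<And>j. j \<in> {1..d + 2} \<Longrightarrow> norm (\<delta> (j * N)) \<le> R / real (j * N)\<rbrakk> \<Longrightarrow>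
      decimated_poly d N m \<noteq> 0 \<and> (\<exists>u. poly (decimated_poly d N m) u = 0) \<and>
      (\<forall>z. is_arg_min (\<lambda>u. infdist u (sphere 0 1)) (\<lambda>u. poly (decimated_poly d N m) u = 0) z \<longrightarrow>
         norm (z / w - 1) \<le> C * (R / (B * real N ^ (d + 1))))"
    by (fact decimated_root_estimate[of d])
  define C5 where "C5 = (\<lambda>l. (real (d + 1) ^ (d + 2) * 2 ^ (d + 2) * C + 2 ^ (d + 1)) *
      (\<Sum>j\<in>{1..d + 1}. norm (coeff (lagrange_basis d j) l)))"
  show ?thesis
  proof (rule exI[of _ "2 * C"], rule exI[of _ C5], intro allI impI, elim conjE)
    fix A B R :: real and \<rho> :: "nat \<Rightarrow> real"
    assume pos: "A > 0" "B > 0" "R > 0" and \<rho>: "\<rho> \<longlonglongrightarrow> 0"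
    have "\<forall>\<^sub>F N in sequentially. (A / B) / real N < \<epsilon>"
      using \<epsilon> by (intro order_tendstoD(2)[OF lim_const_over_n])
    moreover have "\<forall>\<^sub>F N in sequentially. (R / B) / real N < min \<epsilon> (1 / (32 * C))"
      using \<epsilon> C by (intro order_tendstoD(2)[OF lim_const_over_n]) auto
    moreover have "\<forall>\<^sub>F N in sequentially. \<rho> N < 1 / 8"
      using \<rho> by (rule order_tendstoD) simp
    moreover have "\<forall>\<^sub>F N in sequentially. 0 < N" by (rule eventually_gt_at_top)
    ultimately have "\<forall>\<^sub>F N in sequentially. 0 < N \<and> A / (B * real N) \<le> \<epsilon> \<and>
        R / (B * real N) \<le> \<epsilon> \<and> R / (B * real N) \<le> 1 / (32 * C) \<and> \<rho> N \<le> 1 / 8"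
      by eventually_elim auto
    then obtain N0 where N0: "\<And>N. N \<ge> N0 \<Longrightarrow> 0 < N \<and> A / (B * real N) \<le> \<epsilon> \<and>
        R / (B * real N) \<le> \<epsilon> \<and> R / (B * real N) \<le> 1 / (32 * C) \<and> \<rho> N \<le> 1 / 8"
      unfolding eventually_sequentially by blast
    show "\<exists>N0. \<forall>N\<ge>N0. \<forall>(\<xi> :: real) (a :: nat \<Rightarrow> complex) (\<delta> :: nat \<Rightarrow> complex)
          (m :: nat \<Rightarrow> complex) (\<xi>0 :: real).
        \<xi> \<in> {- pi..pi} \<and>
        (\<forall>l\<le>d. norm (a l) \<le> A) \<and> norm (a 0) \<ge> B \<and>
        (\<forall>j\<in>{1..d + 2}. m (j * N) = jump_moment d \<xi> a (j * N) + \<delta> (j * N)) \<and>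
        (\<forall>j\<in>{1..d + 2}. norm (\<delta> (j * N)) \<le> R / real (j * N)) \<and>
        \<bar>\<xi>0 - \<xi>\<bar> \<le> \<rho> N / real N \<longrightarrow>
        (\<exists>\<xi>' \<alpha>'. decimated_output d N m \<xi>0 \<xi>' \<alpha>') \<and>
        (\<forall>\<xi>' \<alpha>'. decimated_output d N m \<xi>0 \<xi>' \<alpha>' \<longrightarrow>
           \<bar>\<xi>' - \<xi>\<bar> \<le> 2 * C * (R / B) / real N ^ (d + 2) \<and>
           (\<forall>l\<le>d. norm (\<alpha>' l - jump_alpha d a l)
                    \<le> C5 l * R * (1 + A / B) / real N ^ (l + 1)))"
    proof (rule exI[of _ N0], intro allI impI, elim conjE)
      fix N and \<xi> \<xi>0 :: real and a \<delta> m :: "nat \<Rightarrow> complex"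
      assume "N0 \<le> N" and a: "\<forall>l\<le>d. norm (a l) \<le> A" "norm (a 0) \<ge> B"
        and m: "\<forall>j\<in>{1..d + 2}. m (j * N) = jump_moment d \<xi> a (j * N) + \<delta> (j * N)"
        and \<delta>: "\<forall>j\<in>{1..d + 2}. norm (\<delta> (j * N)) \<le> R / real (j * N)"
        and \<xi>0: "\<bar>\<xi>0 - \<xi>\<bar> \<le> \<rho> N / real N"
      have N: "0 < N" "A / (B * real N) \<le> \<epsilon>" "R / (B * real N) \<le> \<epsilon>"
        "R / (B * real N) \<le> 1 / (32 * C)" "\<rho> N \<le> 1 / 8"
        using N0[OF \<open>N0 \<le> N\<close>] by auto
      have "\<rho> N / real N \<le> (1 / 8) / real N" using N by (intro divide_right_mono) auto
      then have \<xi>0': "\<bar>\<xi>0 - \<xi>\<bar> \<le> 1 / (8 * real N)" using \<xi>0 by simp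
      have small: "C * (R / (B * real N ^ (d + 1))) \<le> 1 / 32"
      proof -
        have "real N ^ 1 \<le> real N ^ (d + 1)" using N by (intro power_increasing) auto
        then have "R / (B * real N ^ (d + 1)) \<le> R / (B * real N)"
          using pos N by (intro divide_left_mono mult_left_mono) auto
        then have "C * (R / (B * real N ^ (d + 1))) \<le> C * (1 / (32 * C))"
          using N(4) C by (intro mult_left_mono) auto
        then show ?thesis using C by simp
      qed
      define w where "w = exp (- \<i> * of_real \<xi>) ^ N"
      have e1: "norm (exp (- \<i> * of_real \<xi>)) = 1" using norm_exp_i_times[of "- \<xi>"] by simp
      then have nw: "norm w = 1" by (simp only: w_def norm_power power_one)
      have "decimated_poly d N m \<noteq> 0 \<and> (\<exists>u. poly (decimated_poly d N m) u = 0) \<and>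
        (\<forall>z. is_arg_min (\<lambda>u. infdist u (sphere 0 1)) (\<lambda>u. poly (decimated_poly d N m) u = 0) z \<longrightarrow>
           norm (z / w - 1) \<le> C * (R / (B * real N ^ (d + 1))))"
      proof (rule root[OF pos N(1-3) nw, where \<alpha> = "jump_alpha d a" and \<delta> = \<delta>])
        fix j assume "j \<in> {1..d + 2}"
        moreover have "w ^ j = exp (- \<i> * of_real \<xi>) ^ (j * N)"
          unfolding w_def by (simp only: mult.commute[of j N] power_mult)
        ultimately show "m (j * N) = w ^ j * (\<Sum>l\<le>d. jump_alpha d a l * of_nat (j * N) ^ l) + \<delta> (j * N)"
          using m by (simp add: jump_moment_def)
      qed (use a \<delta> in \<open>auto simp: jump_alpha_def norm_mult norm_power\<close>)
      then have ne: "decimated_poly d N m \<noteq> 0" and ex: "\<exists>u. poly (decimated_poly d N m) u = 0" and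
        close: "\<And>z. is_arg_min (\<lambda>u. infdist u (sphere 0 1)) (\<lambda>u. poly (decimated_poly d N m) u = 0) z \<Longrightarrow>
           norm (z / exp (- \<i> * of_real \<xi>) ^ N - 1) \<le> C * (R / (B * real N ^ (d + 1)))"
        unfolding w_def by blast+
      have "\<exists>\<xi>' \<alpha>'. decimated_output d N m \<xi>0 \<xi>' \<alpha>'"
        using ex decimated_output_exists[OF N(1) ne] by blast
      moreover have "\<bar>\<xi>' - \<xi>\<bar> \<le> 2 * C * (R / B) / real N ^ (d + 2)"
        and "\<And>l. l \<le> d \<Longrightarrow> norm (\<alpha>' l - jump_alpha d a l) \<le> C5 l * R * (1 + A / B) / real N ^ (l + 1)"
        if out: "decimated_output d N m \<xi>0 \<xi>' \<alpha>'" for \<xi>' \<alpha>'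
      proof -
        note err = decimated_output_error[OF pos N(1) C _ _ _ \<xi>0' small close out,
            where a = a and \<delta> = \<delta>]
        show "\<bar>\<xi>' - \<xi>\<bar> \<le> 2 * C * (R / B) / real N ^ (d + 2)"
          using a(1) m \<delta> by (intro err(1)) blast+
        show "norm (\<alpha>' l - jump_alpha d a l) \<le> C5 l * R * (1 + A / B) / real N ^ (l + 1)"
          if "l \<le> d" for l
          unfolding C5_def using a(1) m \<delta> that by (intro err(2)) blast+
      qed
      ultimately show "(\<exists>\<xi>' \<alpha>'. decimated_output d N m \<xi>0 \<xi>' \<alpha>') \<and>
        (\<forall>\<xi>' \<alpha>'. decimated_output d N m \<xi>0 \<xi>' \<alpha>' \<longrightarrow>
           \<bar>\<xi>' - \<xi>\<bar> \<le> 2 * C * (R / B) / real N ^ (d + 2) \<and>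
           (\<forall>l\<le>d. norm (\<alpha>' l - jump_alpha d a l)
                    \<le> C5 l * R * (1 + A / B) / real N ^ (l + 1)))"
        by blast
    qed
  qed
qed

end
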